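(* Consider a Köthe sequence space $X:=\lambda_p(A,\mathbb{Z})$, where $A:=(a_{j,k})_{j\in\mathbb{Z},k\in\mathbb{N}}$ is a Köthe matrix and $p\in\{0\}\cup[1,\infty)$. Let $w:=(w_n)_{n\in\mathbb{Z}}$ be a sequence of nonzero scalars such that the bilateral weighted backward shift $B_w$ is a well-defined and continuous operator on $X$. (a) If $p=0$, then $B_w$ is distributionally chaotic if and only if there exist $D\subset\mathbb{N}$ with $\overline{\operatorname{dens}}(D)=1$ and $I\subset\mathbb{Z}$ such that the following conditions hold: (A1) $\lim_{n\in D}a_{i-n,k}w_{i-n}\cdots w_{i-1}=0$ for all $k\in\mathbb{N}$ and $i\in I$. (A2) There exist $m\in\mathbb{N}$ and an increasing sequence $(N_k)_{k\in\mathbb{N}}$ of positive integers such that for each $k\in\mathbb{N}$ there are $r:=r(k)\in\mathbb{N}$, indices $i_{1,k},\dots,i_{r,k}\in I$ and scalars $b_{1,k},\dots,b_{r,k}\in\mathbb{K}\setminus\{0\}$ with $\max_{1\le j\le r}|a_{i_{j,k},p(k)}b_{j,k}|>0$ and $$\operatorname{card}\left\{1\le n\le N_k:\frac{\max_{1\le j\le r}\left|a_{i_{j,k}-n,m}b_{j,k}w_{i_{j,k}-n}\cdots w_{i_{j,k}-1}\right|}{\max_{1\le j\le r}\left|a_{i_{j,k},p(k)}b_{j,k}\right|}>k\right\}>(1-k^{-1})N_k,$$ where $p(k):=m$ if $1\le k\le m$, and $p(k):=k$ if $k>m$. (b) If $p\in[1,\infty)$, then $B_w$ is distributionally chaotic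 if and only if there exist $D\subset\mathbb{N}$ with $\overline{\operatorname{dens}}(D)=1$ and $I\subset\mathbb{Z}$ such that the following conditions hold: (B1) $\lim_{n\in D}a_{i-n,k}w_{i-n}\cdots w_{i-1}=0$ for all $k\in\mathbb{N}$ and $i\in I$. (B2) There exist $m\in\mathbb{N}$ and an increasing sequence $(N_k)_{k\in\mathbb{N}}$ of positive integers such that for each $k\in\mathbb{N}$ there are $r:=r(k)\in\mathbb{N}$, indices $i_{1,k},\dots,i_{r,k}\in I$ and scalars $b_{1,k},\dots,b_{r,k}\in\mathbb{K}\setminus\{0\}$ with $\sum_{j=1}^{r}|a_{i_{j,k},p(k)}b_{j,k}|^p>0$ and $$\operatorname{card}\left\{1\le n\le N_k:\frac{\sum_{j=1}^{r}\left|a_{i_{j,k}-n,m}b_{j,k}w_{i_{j,k}-n}\cdots w_{i_{j,k}-1}\right|^p}{\sum_{j=1}^{r}\left|a_{i_{j,k},p(k)}b_{j,k}\right|^p}>k^p\right\}>(1-k^{-1})N_k,$$ where $p(k):=m$ if $1\le k\le m$, and $p(k):=k$ if $k>m$.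
   Context: $\mathbb{K}$ is $\mathbb{R}$ or $\mathbb{C}$; $\mathbb{N}=\{1,2,3,\dots\}$. The symbol $p$ alone denotes the fixed exponent of the space, whereas $p(k)$ denotes the index function of $k$ defined in the statement; the two are unrelated. $\lim_{n\in D}$ means the limit as $n\to\infty$ with $n\in D$. A Köthe matrix is a matrix $A=(a_{j,k})_{j\in\mathbb{Z},k\in\mathbb{N}}$ with $a_{j,k}\ge 0$ and $a_{j,k}\le a_{j,k+1}$ for all $j,k$, and such that for each $j\in\mathbb{Z}$ there is at least one $k\in\mathbb{N}$ with $a_{j,k}>0$. For $p\in[1,\infty)$, $\lambda_p(A,\mathbb{Z}):=\{(x_j)_{j\in\mathbb{Z}}\in\mathbb{K}^{\mathbb{Z}}:\sum_{j\in\mathbb{Z}}|a_{j,k}x_j|^p<\infty\text{ for all }k\in\mathbb{N}\}$ with the seminorms $\|x\|_k:=\left(\sum_{j\in\mathbb{Z}}|a_{j,k}x_j|^p\right)^{1/p}$, $k\in\mathbb{N}$. For $p=0$, $\lambda_0(A,\mathbb{Z}):=\{(x_j)_{j\in\mathbb{Z}}\in\mathbb{K}^{\mathbb{Z}}:\lim_{|j|\to\infty}a_{j,k}x_j=0\text{ for all }k\in\mathbb{N}\}$ with the seminorms $\|x\|_k:=\sup_{j\in\mathbb{Z}}|a_{j,k}x_j|$, $k\in\mathbb{N}$. These are Fréchet spaces, considered with the metric $d(x,y):=\sum_{k=1}^{\infty}2^{-k}\min\{1,\|x-y\|_k\}$. The bilateral weighted backward shift is $B_w((x_n)_{n\in\mathbb{Z}}):=(w_nx_{n+1})_{n\in\mathbb{Z}}$;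 it is well-defined on $X$ if it maps $X$ into itself. For $S\subset\mathbb{N}$, $\overline{\operatorname{dens}}(S):=\limsup_{N\to\infty}\frac{\operatorname{card}(\{1,\dots,N\}\cap S)}{N}$. A map $f:M\to M$ on a metric space $(M,d)$ is distributionally chaotic if there exist an uncountable set $\Gamma\subset M$ and $\varepsilon>0$ such that for each pair $(x,y)$ of distinct points of $\Gamma$, $$\liminf_{k\to\infty}\frac{\operatorname{card}\{n\in\{1,\dots,k\}:d(f^n(x),f^n(y))<\varepsilon\}}{k}=0$$ and, for all $\tau>0$, $$\limsup_{k\to\infty}\frac{\operatorname{card}\{n\in\{1,\dots,k\}:d(f^n(x),f^n(y))<\tau\}}{k}=1.$$ *)

theory Defs
  imports "HOL-Analysis.Analysis"
begin

text \<open>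
  The scalar field \<open>\<bbbK>\<close> is a type variable of sort \<open>{real_normed_field, banach}\<close>. By the Gelfand--Mazur
  theorem the real and the complex numbers are, up to isometric isomorphism, the only such fields.
  Indices in \<open>\<nat> = {1, 2, 3, \<dots>}\<close> are represented by type \<open>nat\<close> with explicit guards \<open>k \<ge> 1\<close>; the values
  \<open>a j 0\<close> of a matrix are never used.
\<close>

definition koethe_matrix :: "(int \<Rightarrow> nat \<Rightarrow> real) \<Rightarrow> bool" where
  "koethe_matrix a \<longleftrightarrow>
     (\<forall>j. \<forall>k\<ge>1. 0 \<le> a j k \<and> a j k \<le> a j (k + 1)) \<and> (\<forall>j. \<exists>k\<ge>1. a j k > 0)"

text \<open>The exponent \<open>p\<close> ranges over \<open>{0} \<union> [1, \<infinity>)\<close>; the value 0 stands for the \<open>c\<^sub>0\<close>-type space.\<close>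

definition koethe_space ::
  "real \<Rightarrow> (int \<Rightarrow> nat \<Rightarrow> real) \<Rightarrow> (int \<Rightarrow> 'a::{real_normed_field,banach}) set" where
  "koethe_space p a =
     (if p = 0
      then {x. \<forall>k\<ge>1. ((\<lambda>j. a j k *\<^sub>R x j) \<longlongrightarrow> 0) (filtercomap (\<lambda>j. \<bar>j\<bar>) at_top)}
      else {x. \<forall>k\<ge>1. (\<lambda>j. norm (a j k *\<^sub>R x j) powr p) summable_on UNIV})"

definition koethe_seminorm ::
  "real \<Rightarrow> (int \<Rightarrow> nat \<Rightarrow> real) \<Rightarrow> nat \<Rightarrow> (int \<Rightarrow> 'a::{real_normed_field,banach}) \<Rightarrow> real" where
  "koethe_seminorm p a k x =
     (if p = 0
      then (SUP j. norm (a j k *\<^sub>R x j))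
      else (\<Sum>\<^sub>\<infinity>j. norm (a j k *\<^sub>R x j) powr p) powr (1 / p))"

text \<open>
  The locale \<open>Metric_space\<close> demands nonnegativity and symmetry for all arguments, not only those in
  the carrier; hence the value 0 outside the space, where the seminorms are meaningless.
  The series is shifted by one, since \<open>suminf\<close> starts at 0.
\<close>

definition koethe_dist ::
  "real \<Rightarrow> (int \<Rightarrow> nat \<Rightarrow> real) \<Rightarrow> (int \<Rightarrow> 'a::{real_normed_field,banach}) \<Rightarrow> (int \<Rightarrow> 'a) \<Rightarrow> real" where
  "koethe_dist p a x y =
     (if x \<in> koethe_space p a \<and> y \<in> koethe_space p a
      then (\<Sum>k. (1 / 2) ^ Suc k * min 1 (koethe_seminorm p a (Suc k) (\<lambda>j. x j - y j)))
      else 0)"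

abbreviation koethe_topology ::
  "real \<Rightarrow> (int \<Rightarrow> nat \<Rightarrow> real) \<Rightarrow> (int \<Rightarrow> 'a::{real_normed_field,banach}) topology" where
  "koethe_topology p a \<equiv> Metric_space.mtopology (koethe_space p a) (koethe_dist p a)"

definition backward_shift ::
  "(int \<Rightarrow> 'a::{real_normed_field,banach}) \<Rightarrow> (int \<Rightarrow> 'a) \<Rightarrow> (int \<Rightarrow> 'a)" where
  "backward_shift w x = (\<lambda>n. w n * x (n + 1))"

text \<open>The product \<open>w\<^bsub>i-n\<^esub> \<cdots> w\<^bsub>i-1\<^esub>\<close> (of \<open>n\<close> factors).\<close>

definition weight_prod :: "(int \<Rightarrow> 'a::{real_normed_field,banach}) \<Rightarrow> int \<Rightarrow> nat \<Rightarrow> 'a" where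
  "weight_prod w i n = (\<Prod>l\<in>{i - int n..i - 1}. w l)"

definition upper_density :: "nat set \<Rightarrow> ereal" where
  "upper_density S = limsup (\<lambda>N. ereal (real (card ({1..N} \<inter> S)) / real N))"

definition distributionally_chaotic :: "'b set \<Rightarrow> ('b \<Rightarrow> 'b \<Rightarrow> real) \<Rightarrow> ('b \<Rightarrow> 'b) \<Rightarrow> bool" where
  "distributionally_chaotic M d f \<longleftrightarrow>
     (\<exists>\<Gamma> \<epsilon>. \<Gamma> \<subseteq> M \<and> uncountable \<Gamma> \<and> \<epsilon> > 0 \<and>
        (\<forall>x\<in>\<Gamma>. \<forall>y\<in>\<Gamma>. x \<noteq> y \<longrightarrow>
           liminf (\<lambda>k. ereal (real (card {n \<in> {1..k}. d ((f ^^ n) x) ((f ^^ n) y) < \<epsilon>}) / real k)) = 0 \<and>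
           (\<forall>\<tau>>0.
              limsup (\<lambda>k. ereal (real (card {n \<in> {1..k}. d ((f ^^ n) x) ((f ^^ n) y) < \<tau>}) / real k)) = 1)))"

text \<open>The index function \<open>k \<mapsto> p(k)\<close> (unrelated to the exponent), which depends on \<open>m\<close>.\<close>

definition index_fun :: "nat \<Rightarrow> nat \<Rightarrow> nat" where
  "index_fun m k = (if k \<le> m then m else k)"

end

theory Submission
  imports Defs
begin

text \<open>
  A scrambled pair \<open>x, y\<close> yields \<open>u = x - y\<close> with \<open>T\<^sup>n u \<rightarrow> 0\<close> along a set \<open>D\<close> of upper density one,
  while \<open>\<parallel>T\<^sup>n u\<parallel>\<^sub>m\<close> stays away from zero along another such set. Taking for \<open>I\<close> the union of the supports
  of all \<open>T\<^sup>s u\<close>, finite truncations of \<open>T\<^sup>s u\<close> with \<open>s \<in> D\<close> are small vectors with large orbits.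

  Conversely, the finite vectors of the second condition may be replaced by their absolute values, since
  the seminorms are solid and a weighted shift acts coordinatewise up to a translation. The sum \<open>x\<close> of a
  sparse subsequence then has an orbit dominating that of every summand, hence a distributionally
  unbounded one, whereas sparseness and the first condition make it distributionally null.
  The line spanned by \<open>x\<close> is scrambled.
\<close>

subsection \<open>Finite weighted norms\<close>

text \<open>In the necessity direction the orbit of \<open>u\<close> is only bounded away from zero,
  so the factor \<open>k\<close> in the quotients has to come from the denominators:
  \<open>s\<close> in \<open>D\<close> is chosen so late that \<open>T s u\<close> is smaller than a
  fixed multiple of \<open>1/k\<close> in the seminorm of index \<open>index_fun m k\<close>. The
  supports of all \<open>T s u\<close> are admissible because the iterates commute: coordinate
  \<open>i\<close> of \<open>T s u\<close> reappears, weighted, at \<open>i - n\<close> in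
  \<open>T s (T n u)\<close>, which tends to zero along \<open>D\<close> by continuity of
  \<open>T s\<close>.

  In the sufficiency direction the growth of \<open>index_fun m k\<close> is what makes the
  normalised vectors tend to zero in every seminorm. Norm \<open>1 / sqrt k\<close> shares the
  factor \<open>k\<close> equally: the vectors tend to zero while their orbits exceed
  \<open>sqrt k\<close> most of the time. Each summand is controlled at early times by continuity of
  finitely many iterates and at late times in \<open>D\<close> by the first condition. Neither
  controls the times in between, so the windows on which the whole sum is small must be chosen
  alternately with the summands.\<close>

text \<open>The maximum or the \<open>p\<close>-norm of a nonnegative family over a finite set.
  Inserting 0 gives the empty set norm 0 also for \<open>p = 0\<close>, so that both cases obey the
  same laws.\<close>

definition fnorm :: "real \<Rightarrow> 'i set \<Rightarrow> ('i \<Rightarrow> real) \<Rightarrow> real" where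
  "fnorm p F v =
     (if p = 0 then Max (insert 0 (v ` F)) else (\<Sum>j\<in>F. v j powr p) powr (1 / p))"

lemma fnorm_0_le_iff:
  "finite F \<Longrightarrow> fnorm 0 F v \<le> C \<longleftrightarrow> 0 \<le> C \<and> (\<forall>j\<in>F. v j \<le> C)"
  by (simp add: fnorm_def)

lemma fnorm_0_less_iff:
  "finite F \<Longrightarrow> fnorm 0 F v < C \<longleftrightarrow> 0 < C \<and> (\<forall>j\<in>F. v j < C)"
  by (simp add: fnorm_def)

lemma fnorm_0_ge: "finite F \<Longrightarrow> j \<in> F \<Longrightarrow> v j \<le> fnorm 0 F v"
  using fnorm_0_le_iff by blast

lemma fnorm_nonneg: "finite F \<Longrightarrow> 0 \<le> fnorm p F v"
  using fnorm_0_le_iff[of F v "fnorm 0 F v"] by (cases "p = 0") (simp_all add: fnorm_def)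

lemma fnorm_empty [simp]: "fnorm p {} v = 0"
  by (simp add: fnorm_def)

lemma fnorm_powr:
  assumes "p \<ge> 1"
  shows "fnorm p F v powr p = (\<Sum>j\<in>F. v j powr p)"
  using assms by (simp add: fnorm_def powr_powr sum_nonneg)

lemma fnorm_mono:
  assumes p: "p = 0 \<or> p \<ge> 1" and "finite G" "F \<subseteq> G"
    and "\<And>j. j \<in> F \<Longrightarrow> 0 \<le> v j" "\<And>j. j \<in> F \<Longrightarrow> v j \<le> u j"
  shows "fnorm p F v \<le> fnorm p G u"
proof (cases "p = 0")
  case True
  have F: "finite F" using assms finite_subset by blast
  show ?thesis unfolding True fnorm_0_le_iff[OF F]
    using fnorm_nonneg[OF \<open>finite G\<close>] fnorm_0_ge[OF \<open>finite G\<close>] assms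
    by (meson order_trans subset_iff)
next
  case False
  then have p1: "p \<ge> 1" using p by simp
  have "(\<Sum>j\<in>F. v j powr p) \<le> (\<Sum>j\<in>F. u j powr p)"
    using assms p1 by (intro sum_mono powr_mono2) auto
  also have "\<dots> \<le> (\<Sum>j\<in>G. u j powr p)"
    using assms by (intro sum_mono2) auto
  finally show ?thesis
    using False p1 by (auto simp: fnorm_def intro!: powr_mono2 sum_nonneg)
qed

lemma fnorm_ge:
  assumes "p = 0 \<or> p \<ge> 1" "finite F" "j \<in> F" "0 \<le> v j"
  shows "v j \<le> fnorm p F v"
proof -
  have "v j = fnorm p {j} v"
    using assms by (auto simp: fnorm_def powr_powr)
  also have "\<dots> \<le> fnorm p F v"
    using assms by (intro fnorm_mono) auto
  finally show ?thesis .
qed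

lemma fnorm_0_le:
  assumes "finite F" "0 \<le> C" "\<And>j. j \<in> F \<Longrightarrow> v j \<le> C"
  shows "fnorm 0 F v \<le> C"
  using assms fnorm_0_le_iff by blast

lemma fnorm_scale:
  assumes p: "p = 0 \<or> p \<ge> 1" and F: "finite F" and c: "0 \<le> c"
    and v: "\<And>j. j \<in> F \<Longrightarrow> 0 \<le> v j"
  shows "fnorm p F (\<lambda>j. c * v j) = c * fnorm p F v"
proof (cases "p = 0")
  case True
  show ?thesis
  proof (cases "c = 0")
    case True
    then show ?thesis
      using fnorm_0_le_iff[OF F, of "\<lambda>_. 0" 0] fnorm_nonneg[OF F, of 0 "\<lambda>_. 0"] \<open>p = 0\<close> by simp
  next
    case False
    then have c: "c > 0" using c by simp
    \<comment> \<open>Equality is obtained by showing that both numbers have the same upper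
      bounds.\<close>
    have "C \<ge> fnorm 0 F (\<lambda>j. c * v j) \<longleftrightarrow> C \<ge> c * fnorm 0 F v" for C
    proof -
      have "C \<ge> c * fnorm 0 F v \<longleftrightarrow> fnorm 0 F v \<le> C / c"
        using c by (simp add: pos_le_divide_eq mult.commute)
      also have "\<dots> \<longleftrightarrow> fnorm 0 F (\<lambda>j. c * v j) \<le> C"
        using c by (simp add: fnorm_0_le_iff[OF F] pos_le_divide_eq mult.commute)
      finally show ?thesis ..
    qed
    then show ?thesis using \<open>p = 0\<close> by (metis order_antisym order_refl)
  qed
next
  case False
  then have p1: "p \<ge> 1" using p by simp
  have "(\<Sum>j\<in>F. (c * v j) powr p) = c powr p * (\<Sum>j\<in>F. v j powr p)"
    using c v by (simp add: powr_mult sum_distrib_left)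
  then show ?thesis
    using False p1 c by (simp add: fnorm_def powr_mult powr_powr sum_nonneg)
qed

text \<open>Convexity of the power is applied to positive \<open>s\<close> and \<open>t\<close>; if
  one of them is 0, the claim reduces to \<open>l powr p \<le> l\<close> for
  \<open>0 < l < 1\<close>.\<close>

lemma powr_convex_combination:
  fixes s t :: real
  assumes p: "p \<ge> 1" and l: "0 < l" "l < 1" and st: "0 \<le> s" "0 \<le> t"
  shows "(l * s + (1 - l) * t) powr p \<le> l * s powr p + (1 - l) * t powr p"
proof -
  have sub: "(l * s) powr p \<le> l * s powr p" if "0 < l" "l < 1" "0 \<le> s" for l s :: real
  proof -
    have "l powr p \<le> l powr 1" using that p by (intro powr_mono') auto
    then show ?thesis using that by (simp add: powr_mult mult_right_mono)
  qed
  consider "s = 0" | "t = 0" | "s > 0" "t > 0" using st by fastforce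
  then show ?thesis
  proof cases
    case 1
    then show ?thesis using sub[of "1 - l" t] l st p by simp
  next
    case 2
    then show ?thesis using sub[of l s] l st p by simp
  next
    case 3
    then show ?thesis
      using convex_onD[OF powr_convex[OF p], of "1 - l" s t] l by (simp add: algebra_simps)
  qed
qed

text \<open>For \<open>p \<ge> 1\<close> this is Minkowski's inequality, derived from convexity of
  the power by normalising both vectors. A vector of norm zero vanishes on \<open>F\<close>, which
  settles the cases that cannot be normalised.\<close>

lemma fnorm_triangle:
  assumes p: "p = 0 \<or> p \<ge> 1" and F: "finite F"
    and u: "\<And>j. j \<in> F \<Longrightarrow> 0 \<le> u j" and v: "\<And>j. j \<in> F \<Longrightarrow> 0 \<le> v j"
  shows "fnorm p F (\<lambda>j. u j + v j) \<le> fnorm p F u + fnorm p F v"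
proof (cases "p = 0")
  case True
  then show ?thesis
    using fnorm_0_ge[OF F, of _ u] fnorm_0_ge[OF F, of _ v] fnorm_nonneg[OF F, of 0]
    by (auto intro!: fnorm_0_le[OF F] add_mono add_nonneg_nonneg)
next
  case False
  then have p1: "p \<ge> 1" using p by simp
  define A B where "A = fnorm p F u" and "B = fnorm p F v"
  have A0: "A \<ge> 0" and B0: "B \<ge> 0" by (simp_all add: A_def B_def fnorm_nonneg F)
  have uA: "u j \<le> A" and vB: "v j \<le> B" if "j \<in> F" for j
    using fnorm_ge[OF p F that] u v that by (auto simp: A_def B_def)
  consider "A = 0" | "B = 0" | "A > 0" "B > 0" using A0 B0 by fastforce
  then show ?thesis
  proof cases
    case 1
    then have "fnorm p F (\<lambda>j. u j + v j) \<le> fnorm p F v"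
      using uA u v by (intro fnorm_mono[OF p F]) fastforce+
    then show ?thesis using 1 by (simp add: A_def)
  next
    case 2
    then have "fnorm p F (\<lambda>j. u j + v j) \<le> fnorm p F u"
      using vB u v by (intro fnorm_mono[OF p F]) fastforce+
    then show ?thesis using 2 by (simp add: B_def)
  next
    case 3
    \<comment> \<open>Weights proportional to the norms turn \<open>u + v\<close> into
      \<open>A + B\<close> times a convex combination of the unit vectors \<open>u / A\<close> and
      \<open>v / B\<close>.\<close>
    define l where "l = A / (A + B)"
    have l: "0 < l" "l < 1" "1 - l = B / (A + B)"
      using 3 by (auto simp: l_def field_simps)
    have *: "(u j + v j) powr p \<le> (A + B) powr p * (l * (u j / A) powr p + (1 - l) * (v j / B) powr p)"
      if "j \<in> F" for j
    proof -
      have "u j + v j = (A + B) * (l * (u j / A) + (1 - l) * (v j / B))"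
      proof -
        have "(A + B) * (l * (u j / A) + (1 - l) * (v j / B)) =
            (A + B) * (A / (A + B)) * (u j / A) + (A + B) * (B / (A + B)) * (v j / B)"
          unfolding l(3) by (simp add: l_def algebra_simps)
        then show ?thesis using 3 by simp
      qed
      then have "(u j + v j) powr p = (A + B) powr p * (l * (u j / A) + (1 - l) * (v j / B)) powr p"
        using 3 l u[OF that] v[OF that] by (simp add: powr_mult)
      also have "\<dots> \<le> (A + B) powr p * (l * (u j / A) powr p + (1 - l) * (v j / B) powr p)"
        using 3 l u[OF that] v[OF that] by (intro mult_left_mono powr_convex_combination p1) auto
      finally show ?thesis .
    qed
    have sA: "(\<Sum>j\<in>F. (u j / A) powr p) = 1"
    proof -
      have "(\<Sum>j\<in>F. (u j / A) powr p) = (\<Sum>j\<in>F. u j powr p) / A powr p"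
        using 3 u by (simp add: powr_divide sum_divide_distrib)
      also have "\<dots> = A powr p / A powr p"
        using fnorm_powr[OF p1, of F u] by (simp add: A_def)
      finally show ?thesis using 3 by simp
    qed
    have sB: "(\<Sum>j\<in>F. (v j / B) powr p) = 1"
    proof -
      have "(\<Sum>j\<in>F. (v j / B) powr p) = (\<Sum>j\<in>F. v j powr p) / B powr p"
        using 3 v by (simp add: powr_divide sum_divide_distrib)
      also have "\<dots> = B powr p / B powr p"
        using fnorm_powr[OF p1, of F v] by (simp add: B_def)
      finally show ?thesis using 3 by simp
    qed
    have "(\<Sum>j\<in>F. (u j + v j) powr p) \<le>
        (\<Sum>j\<in>F. (A + B) powr p * (l * (u j / A) powr p + (1 - l) * (v j / B) powr p))"
      using * by (rule sum_mono)
    also have "\<dots> = (A + B) powr p * (l * (\<Sum>j\<in>F. (u j / A) powr p) + (1 - l) * (\<Sum>j\<in>F. (v j / B) powr p))"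
      by (simp add: sum_distrib_left sum.distrib distrib_left)
    also have "\<dots> = (A + B) powr p" by (simp add: sA sB)
    finally have "(\<Sum>j\<in>F. (u j + v j) powr p) powr (1 / p) \<le> ((A + B) powr p) powr (1 / p)"
      using p1 by (intro powr_mono2) (auto intro: sum_nonneg)
    then show ?thesis
      using 3 p1 False by (simp add: fnorm_def powr_powr A_def B_def)
  qed
qed

lemma fnorm_sum_le:
  assumes p: "p = 0 \<or> p \<ge> 1" and F: "finite F" and v: "\<And>n j. 0 \<le> v n j"
  shows "fnorm p F (\<lambda>j. \<Sum>n<(N::nat). v n j) \<le> (\<Sum>n<N. fnorm p F (v n))"
proof (induction N)
  case 0
  have "fnorm p F (\<lambda>j. 0 * 0) = 0 * fnorm p F (\<lambda>j. 0)"
    by (rule fnorm_scale[OF p F]) auto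
  then show ?case by simp
next
  case (Suc N)
  then show ?case
    using fnorm_triangle[OF p F, of "\<lambda>j. \<Sum>n<N. v n j" "v N"] v by (simp add: sum_nonneg)
qed

lemma fnorm_neutral:
  assumes p: "p = 0 \<or> p \<ge> 1" and "finite G" "F \<subseteq> G" "\<And>j. j \<in> F \<Longrightarrow> 0 \<le> v j"
    "\<And>j. j \<in> G - F \<Longrightarrow> v j = 0"
  shows "fnorm p G v = fnorm p F v"
proof (cases "p = 0")
  case True
  have F: "finite F" using assms finite_subset by blast
  have "v j \<le> fnorm 0 F v" if "j \<in> G" for j
    using that assms(5)[of j] fnorm_nonneg[OF F, of 0 v] fnorm_0_ge[OF F, of j v]
    by (cases "j \<in> F") auto
  then have "fnorm p G v \<le> fnorm p F v"
    unfolding True using \<open>finite G\<close> fnorm_nonneg[OF F] by (intro fnorm_0_le) auto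
  then show ?thesis using fnorm_mono[OF p assms(2,3), of v v] assms by force
next
  case False
  have "(\<Sum>j\<in>G. v j powr p) = (\<Sum>j\<in>F. v j powr p)"
    using assms by (intro sum.mono_neutral_right) auto
  then show ?thesis using False by (simp add: fnorm_def)
qed

lemma fnorm_reindex:
  "inj_on h F \<Longrightarrow> fnorm p (h ` F) v = fnorm p F (\<lambda>j. v (h j))"
  by (simp add: fnorm_def image_image sum.reindex)

lemma fnorm_cong:
  "F = G \<Longrightarrow> (\<And>j. j \<in> G \<Longrightarrow> u j = v j) \<Longrightarrow> fnorm p F u = fnorm p G v"
  by (simp add: fnorm_def)

text \<open>The indices \<open>i\<^bsub>j,k\<^esub>\<close> of condition (A2) or (B2) need not be distinct; this lemma merges repeated ones.\<close>

lemma fnorm_fibres: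
  assumes p: "p = 0 \<or> p \<ge> 1" and A: "finite A"
    and c: "\<And>i. 0 \<le> c i" and b: "\<And>j. 0 \<le> b j"
  shows "fnorm p A (\<lambda>j. c (f j) * b j) = fnorm p (f ` A) (\<lambda>i. c i * fnorm p {j \<in> A. f j = i} b)"
proof (cases "p = 0")
  case True
  have fin: "finite {j \<in> A. f j = i}" for i using A by simp
  have "c (f j) * b j \<le> fnorm 0 (f ` A) (\<lambda>i. c i * fnorm 0 {j \<in> A. f j = i} b)" if "j \<in> A" for j
  proof -
    have "c (f j) * b j \<le> c (f j) * fnorm 0 {j' \<in> A. f j' = f j} b"
      using that c by (intro mult_left_mono fnorm_0_ge fin) auto
    also have "\<dots> \<le> fnorm 0 (f ` A) (\<lambda>i. c i * fnorm 0 {j \<in> A. f j = i} b)"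
      using that A by (intro fnorm_0_ge[where v = "\<lambda>i. c i * fnorm 0 {j \<in> A. f j = i} b"]) auto
    finally show ?thesis .
  qed
  then have 1: "fnorm 0 A (\<lambda>j. c (f j) * b j) \<le> fnorm 0 (f ` A) (\<lambda>i. c i * fnorm 0 {j \<in> A. f j = i} b)"
    using A by (intro fnorm_0_le fnorm_nonneg) auto
  have "c i * fnorm 0 {j \<in> A. f j = i} b \<le> fnorm 0 A (\<lambda>j. c (f j) * b j)" if "i \<in> f ` A" for i
  proof -
    have "c i * fnorm 0 {j \<in> A. f j = i} b = fnorm 0 {j \<in> A. f j = i} (\<lambda>j. c i * b j)"
      using c b fin by (intro fnorm_scale[symmetric]) auto
    also have "\<dots> \<le> fnorm 0 A (\<lambda>j. c (f j) * b j)"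
      using A c b by (intro fnorm_mono) auto
    finally show ?thesis .
  qed
  then have 2: "fnorm 0 (f ` A) (\<lambda>i. c i * fnorm 0 {j \<in> A. f j = i} b) \<le> fnorm 0 A (\<lambda>j. c (f j) * b j)"
    using A by (intro fnorm_0_le fnorm_nonneg) auto
  from 1 2 True show ?thesis by simp
next
  case False
  then have p1: "p \<ge> 1" using p by simp
  have "(\<Sum>j\<in>A. (c (f j) * b j) powr p) = (\<Sum>i\<in>f ` A. \<Sum>j\<in>{j \<in> A. f j = i}. (c (f j) * b j) powr p)"
    using A by (rule sum.image_gen)
  also have "\<dots> = (\<Sum>i\<in>f ` A. (c i * fnorm p {j \<in> A. f j = i} b) powr p)"
  proof (rule sum.cong[OF refl])
    fix i assume "i \<in> f ` A"
    have "(\<Sum>j\<in>{j \<in> A. f j = i}. (c (f j) * b j) powr p) = c i powr p * (\<Sum>j\<in>{j \<in> A. f j = i}. b j powr p)"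
      using c b by (simp add: powr_mult sum_distrib_left)
    then show "(\<Sum>j\<in>{j \<in> A. f j = i}. (c (f j) * b j) powr p) = (c i * fnorm p {j \<in> A. f j = i} b) powr p"
      using c by (simp add: powr_mult fnorm_nonneg A fnorm_powr[OF p1])
  qed
  finally show ?thesis using False by (simp add: fnorm_def)
qed

text \<open>Carries norm bounds from partial sums to a coordinatewise limit. For
  \<open>p \<ge> 1\<close> the norm depends continuously on finitely many coordinates; for
  \<open>p = 0\<close> the bound passes to the limit in each coordinate.\<close>

lemma fnorm_LIMSEQ_le:
  assumes p: "p = 0 \<or> p \<ge> 1" and F: "finite F" and v: "\<And>n j. 0 \<le> v n j"
    and lim: "\<And>j. (\<lambda>n. v n j) \<longlonglongrightarrow> u j" and C: "\<And>n. fnorm p F (v n) \<le> C"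
  shows "fnorm p F u \<le> C"
proof (cases "p = 0")
  case True
  have "0 \<le> C" by (rule order_trans[OF fnorm_nonneg[OF F] C])
  moreover have "u j \<le> C" if "j \<in> F" for j
  proof (rule LIMSEQ_le_const2[OF lim])
    show "\<exists>N. \<forall>n\<ge>N. v n j \<le> C"
      using order_trans[OF fnorm_ge[OF p F that v] C] by blast
  qed
  ultimately show ?thesis using True F fnorm_0_le by blast
next
  case False
  then have p1: "p \<ge> 1" using p by simp
  have "(\<lambda>n. fnorm p F (v n)) \<longlonglongrightarrow> fnorm p F u"
    unfolding fnorm_def using False p1 v
    by (auto intro!: tendsto_powr' tendsto_sum lim tendsto_const always_eventually sum_nonneg)
  then show ?thesis by (rule LIMSEQ_le_const2) (use C in auto)
qed

subsection \<open>Vanishing families and their norms\<close>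

text \<open>
  The Cauchy condition of \<open>fvanish\<close> covers both \<open>p\<close>-summability and, for \<open>p = 0\<close>, convergence to zero,
  so that the two kinds of spaces can be treated together.
\<close>

definition fvanish :: "real \<Rightarrow> ('i \<Rightarrow> real) \<Rightarrow> bool" where
  "fvanish p v \<longleftrightarrow>
     (\<forall>\<epsilon>>0. \<exists>F. finite F \<and> (\<forall>G. finite G \<longrightarrow> G \<inter> F = {} \<longrightarrow> fnorm p G v < \<epsilon>))"

text \<open>The norm of the whole family. A real \<open>SUP\<close> is meaningful only for bounded
  sets; here \<open>fvanish\<close> supplies the bound.\<close>

definition lnorm :: "real \<Rightarrow> ('i \<Rightarrow> real) \<Rightarrow> real" where
  "lnorm p v = (SUP F\<in>{F. finite F}. fnorm p F v)"

lemma fnorm_split: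
  assumes p: "p = 0 \<or> p \<ge> 1" and G: "finite G" and v: "\<And>j. 0 \<le> v j"
  shows "fnorm p G v \<le> fnorm p (G \<inter> F) v + fnorm p (G - F) v"
proof -
  define u1 u2 where "u1 = (\<lambda>j. if j \<in> F then v j else 0)" and "u2 = (\<lambda>j. if j \<in> F then 0 else v j)"
  have "fnorm p G v = fnorm p G (\<lambda>j. u1 j + u2 j)"
    by (rule fnorm_cong) (auto simp: u1_def u2_def)
  also have "\<dots> \<le> fnorm p G u1 + fnorm p G u2"
    using v by (intro fnorm_triangle[OF p G]) (auto simp: u1_def u2_def)
  also have "fnorm p G u1 = fnorm p (G \<inter> F) u1"
    using v by (intro fnorm_neutral[OF p G]) (auto simp: u1_def)
  also have "\<dots> = fnorm p (G \<inter> F) v"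
    by (rule fnorm_cong) (auto simp: u1_def)
  also have "fnorm p G u2 = fnorm p (G - F) u2"
    using v by (intro fnorm_neutral[OF p G]) (auto simp: u2_def)
  also have "\<dots> = fnorm p (G - F) v"
    by (rule fnorm_cong) (auto simp: u2_def)
  finally show ?thesis .
qed

text \<open>Beyond a suitable finite \<open>F\<close> all finite restrictions have norm below 1, so
  \<open>fnorm p F v + 1\<close> bounds every restriction.\<close>

lemma fvanish_bdd_above:
  assumes p: "p = 0 \<or> p \<ge> 1" and v: "\<And>j. 0 \<le> v j" and "fvanish p v"
  shows "bdd_above ((\<lambda>F. fnorm p F v) ` {F. finite F})"
proof -
  obtain F where F: "finite F" "\<And>G. finite G \<Longrightarrow> G \<inter> F = {} \<Longrightarrow> fnorm p G v < 1"
    using assms(3) unfolding fvanish_def by (metis zero_less_one)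
  have "fnorm p G v \<le> fnorm p F v + 1" if "finite G" for G
  proof -
    have "fnorm p (G \<inter> F) v \<le> fnorm p F v"
      using v F(1) by (intro fnorm_mono[OF p]) auto
    moreover have "fnorm p (G - F) v < 1"
      using that by (intro F(2)) auto
    ultimately show ?thesis using fnorm_split[where F = F, of p G v, OF p that v] by linarith
  qed
  then show ?thesis by (intro bdd_aboveI2[where M = "fnorm p F v + 1"]) auto
qed

lemma fnorm_le_lnorm:
  assumes "p = 0 \<or> p \<ge> 1" "\<And>j. 0 \<le> v j" "fvanish p v" "finite F"
  shows "fnorm p F v \<le> lnorm p v"
  unfolding lnorm_def using fvanish_bdd_above[OF assms(1-3)] assms(4) by (intro cSUP_upper) auto

lemma lnorm_le:
  assumes "\<And>F. finite F \<Longrightarrow> fnorm p F v \<le> C"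
  shows "lnorm p v \<le> C"
  unfolding lnorm_def using assms by (intro cSUP_least) auto

lemma less_lnormE:
  assumes "p = 0 \<or> p \<ge> 1" "\<And>j. 0 \<le> v j" "fvanish p v" "c < lnorm p v"
  obtains F where "finite F" "c < fnorm p F v"
proof -
  have "\<not> (\<forall>F. finite F \<longrightarrow> fnorm p F v \<le> c)"
    using lnorm_le[of p v c] assms(4) by (meson leD)
  then show ?thesis using that by force
qed

lemma fvanish_mono:
  assumes p: "p = 0 \<or> p \<ge> 1" and u: "\<And>j. 0 \<le> u j" "\<And>j. u j \<le> v j" and "fvanish p v"
  shows "fvanish p u"
  unfolding fvanish_def
proof (intro allI impI)
  fix \<epsilon> :: real assume "\<epsilon> > 0"
  then obtain F where F: "finite F" "\<And>G. finite G \<Longrightarrow> G \<inter> F = {} \<Longrightarrow> fnorm p G v < \<epsilon>"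
    using assms(4) unfolding fvanish_def by metis
  moreover have "fnorm p G u \<le> fnorm p G v" if "finite G" for G
    using that u by (intro fnorm_mono[OF p]) auto
  ultimately show "\<exists>F. finite F \<and> (\<forall>G. finite G \<longrightarrow> G \<inter> F = {} \<longrightarrow> fnorm p G u < \<epsilon>)"
    by (meson le_less_trans)
qed

lemma fvanish_add:
  assumes p: "p = 0 \<or> p \<ge> 1" and u: "\<And>j. 0 \<le> u j" and v: "\<And>j. 0 \<le> v j"
    and uv: "fvanish p u" "fvanish p v"
  shows "fvanish p (\<lambda>j. u j + v j)"
  unfolding fvanish_def
proof (intro allI impI)
  fix \<epsilon> :: real assume "\<epsilon> > 0"
  then have e: "\<epsilon> / 2 > 0" by simp
  obtain F where F: "finite F" "\<And>G. finite G \<Longrightarrow> G \<inter> F = {} \<Longrightarrow> fnorm p G u < \<epsilon> / 2"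
    using uv(1) e unfolding fvanish_def by metis
  obtain F' where F': "finite F'" "\<And>G. finite G \<Longrightarrow> G \<inter> F' = {} \<Longrightarrow> fnorm p G v < \<epsilon> / 2"
    using uv(2) e unfolding fvanish_def by metis
  have "fnorm p G (\<lambda>j. u j + v j) < \<epsilon>" if G: "finite G" "G \<inter> (F \<union> F') = {}" for G
  proof -
    have "G \<inter> F = {}" "G \<inter> F' = {}" using G(2) by auto
    then show ?thesis
      using F(2)[OF G(1)] F'(2)[OF G(1)] fnorm_triangle[OF p G(1), of u v] u v by fastforce
  qed
  then show "\<exists>F. finite F \<and> (\<forall>G. finite G \<longrightarrow> G \<inter> F = {} \<longrightarrow> fnorm p G (\<lambda>j. u j + v j) < \<epsilon>)"
    using F(1) F'(1) by (intro exI[of _ "F \<union> F'"]) auto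
qed

lemma fvanish_finite_support:
  assumes p: "p = 0 \<or> p \<ge> 1" and F: "finite F" "\<And>j. j \<notin> F \<Longrightarrow> v j = 0"
  shows "fvanish p v"
proof -
  have "fnorm p G v = 0" if "finite G" "G \<inter> F = {}" for G
    using fnorm_neutral[OF p that(1), of "{}" v] F(2) that(2) by fastforce
  then show ?thesis unfolding fvanish_def using F(1) by (intro allI impI exI[of _ F]) auto
qed

lemma lnorm_finite_support:
  assumes p: "p = 0 \<or> p \<ge> 1" and v: "\<And>j. 0 \<le> v j" and F: "finite F" "\<And>j. j \<notin> F \<Longrightarrow> v j = 0"
  shows "lnorm p v = fnorm p F v"
proof (rule antisym)
  show "lnorm p v \<le> fnorm p F v"
  proof (rule lnorm_le)
    fix G :: "'a set" assume G: "finite G"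
    have "fnorm p G v = fnorm p (G \<inter> F) v"
      using F v by (intro fnorm_neutral[OF p G]) auto
    also have "\<dots> \<le> fnorm p F v"
      using F v by (intro fnorm_mono[OF p]) auto
    finally show "fnorm p G v \<le> fnorm p F v" .
  qed
  show "fnorm p F v \<le> lnorm p v"
    using assms by (intro fnorm_le_lnorm fvanish_finite_support) auto
qed

text \<open>The first \<open>J\<close> terms keep their norm over \<open>G\<close>, which is small
  if \<open>G\<close> lies far out, and only the tail is estimated by global norms.
  \<open>J = 0\<close> bounds the norm of the sum; a general \<open>J\<close> shows that the sum
  vanishes at infinity.\<close>

lemma fnorm_sums_le:
  assumes p: "p = 0 \<or> p \<ge> 1" and G: "finite G" and v: "\<And>n j. 0 \<le> v n j"
    and van: "\<And>n. fvanish p (v n)" and sm: "summable (\<lambda>n. lnorm p (v n))"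
    and u: "\<And>j. (\<lambda>n. v n j) sums u j"
  shows "fnorm p G u \<le> (\<Sum>n<J. fnorm p G (v n)) + (\<Sum>n. lnorm p (v (n + J)))"
proof (rule fnorm_LIMSEQ_le[OF p G])
  show "(\<lambda>N. \<Sum>n<N. v n j) \<longlonglongrightarrow> u j" for j using u by (simp add: sums_def)
  show "0 \<le> (\<Sum>n<N. v n j)" for N j by (simp add: v sum_nonneg)
  fix N
  have le: "fnorm p G (v n) \<le> lnorm p (v n)" for n by (rule fnorm_le_lnorm[OF p v van G])
  have sm': "summable (\<lambda>n. fnorm p G (v n))"
    by (rule summable_comparison_test[OF _ sm]) (use le fnorm_nonneg[OF G] in auto)
  have "fnorm p G (\<lambda>j. \<Sum>n<N. v n j) \<le> (\<Sum>n<N. fnorm p G (v n))"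
    by (rule fnorm_sum_le[OF p G v])
  also have "\<dots> \<le> (\<Sum>n. fnorm p G (v n))"
    by (rule sum_le_suminf[OF sm']) (auto simp: fnorm_nonneg G)
  also have "\<dots> = (\<Sum>n<J. fnorm p G (v n)) + (\<Sum>n. fnorm p G (v (n + J)))"
    using suminf_split_initial_segment[OF sm', of J] by simp
  also have "(\<Sum>n. fnorm p G (v (n + J))) \<le> (\<Sum>n. lnorm p (v (n + J)))"
    using sm sm' by (intro suminf_le le summable_ignore_initial_segment)
  finally show "fnorm p G (\<lambda>j. \<Sum>n<N. v n j) \<le> (\<Sum>n<J. fnorm p G (v n)) + (\<Sum>n. lnorm p (v (n + J)))"
    by simp
qed

lemma lnorm_sums_le:
  assumes p: "p = 0 \<or> p \<ge> 1" and v: "\<And>n j. 0 \<le> v n j"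
    and van: "\<And>n. fvanish p (v n)" and sm: "summable (\<lambda>n. lnorm p (v n))"
    and u: "\<And>j. (\<lambda>n. v n j) sums u j"
  shows "lnorm p u \<le> (\<Sum>n. lnorm p (v n))"
  using fnorm_sums_le[OF p _ v van sm u, where J = 0] by (intro lnorm_le) auto

lemma fvanish_sums:
  assumes p: "p = 0 \<or> p \<ge> 1" and v: "\<And>n j. 0 \<le> v n j"
    and van: "\<And>n. fvanish p (v n)" and sm: "summable (\<lambda>n. lnorm p (v n))"
    and u: "\<And>j. (\<lambda>n. v n j) sums u j"
  shows "fvanish p u"
  unfolding fvanish_def
proof (intro allI impI)
  fix \<epsilon> :: real assume e: "\<epsilon> > 0"
  have "\<exists>N. \<forall>n\<ge>N. norm (\<Sum>i. lnorm p (v (i + n))) < \<epsilon> / 2"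
    using e by (intro suminf_exist_split[OF _ sm]) simp
  then obtain J where "norm (\<Sum>i. lnorm p (v (i + J))) < \<epsilon> / 2" by blast
  then have J: "(\<Sum>n. lnorm p (v (n + J))) < \<epsilon> / 2" by simp
  \<comment> \<open>The \<open>J\<close> leading terms may contribute \<open>\<epsilon> / 2\<close>
    altogether; \<open>Suc J\<close> avoids a division by zero.\<close>
  define \<delta> where "\<delta> = \<epsilon> / (2 * real (Suc J))"
  have d: "\<delta> > 0" using e by (simp add: \<delta>_def)
  have "\<exists>F. finite F \<and> (\<forall>G. finite G \<longrightarrow> G \<inter> F = {} \<longrightarrow> fnorm p G (v n) < \<delta>)" for n
    using van d unfolding fvanish_def by blast
  then obtain F where F: "\<And>n. finite (F n)" "\<And>n G. finite G \<Longrightarrow> G \<inter> F n = {} \<Longrightarrow> fnorm p G (v n) < \<delta>"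
    by metis
  have "fnorm p G u < \<epsilon>" if G: "finite G" "G \<inter> (\<Union>n<J. F n) = {}" for G
  proof -
    have "fnorm p G (v n) \<le> \<delta>" if "n < J" for n
      using F(2)[OF G(1), of n] G(2) that by fastforce
    then have "(\<Sum>n<J. fnorm p G (v n)) \<le> real J * \<delta>"
      using sum_bounded_above[of "{..<J}" "\<lambda>n. fnorm p G (v n)" \<delta>] by simp
    also have "\<dots> \<le> real (Suc J) * \<delta>" using d by simp
    also have "\<dots> = \<epsilon> / 2" by (simp add: \<delta>_def del: of_nat_Suc)
    finally show ?thesis using fnorm_sums_le[OF p G(1) v van sm u, of J] J by linarith
  qed
  then show "\<exists>F. finite F \<and> (\<forall>G. finite G \<longrightarrow> G \<inter> F = {} \<longrightarrow> fnorm p G u < \<epsilon>)"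
    using F(1) by (intro exI[of _ "\<Union>n<J. F n"]) auto
qed

section \<open>Comparison with limits, summability and suprema\<close>

lemma fvanish_0_iff:
  assumes "\<And>j. 0 \<le> v j"
  shows "fvanish 0 v \<longleftrightarrow> (\<forall>\<epsilon>>0. \<exists>F. finite F \<and> (\<forall>j. j \<notin> F \<longrightarrow> v j < \<epsilon>))"
proof
  assume L: "fvanish 0 v"
  show "\<forall>\<epsilon>>0. \<exists>F. finite F \<and> (\<forall>j. j \<notin> F \<longrightarrow> v j < \<epsilon>)"
  proof (intro allI impI)
    fix \<epsilon> :: real assume "\<epsilon> > 0"
    then obtain F where F: "finite F" "\<And>G. finite G \<Longrightarrow> G \<inter> F = {} \<Longrightarrow> fnorm 0 G v < \<epsilon>"
      using L unfolding fvanish_def by metis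
    have "v j < \<epsilon>" if "j \<notin> F" for j
      using F(2)[of "{j}"] that by (simp add: fnorm_0_less_iff)
    then show "\<exists>F. finite F \<and> (\<forall>j. j \<notin> F \<longrightarrow> v j < \<epsilon>)" using F(1) by blast
  qed
next
  assume R: "\<forall>\<epsilon>>0. \<exists>F. finite F \<and> (\<forall>j. j \<notin> F \<longrightarrow> v j < \<epsilon>)"
  show "fvanish 0 v"
    unfolding fvanish_def
  proof (intro allI impI)
    fix \<epsilon> :: real assume e: "\<epsilon> > 0"
    then obtain F where F: "finite F" "\<And>j. j \<notin> F \<Longrightarrow> v j < \<epsilon>" using R by blast
    then show "\<exists>F. finite F \<and> (\<forall>G. finite G \<longrightarrow> G \<inter> F = {} \<longrightarrow> fnorm 0 G v < \<epsilon>)"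
      using e by (intro exI[of _ F]) (auto simp: fnorm_0_less_iff)
  qed
qed

text \<open>Bounded partial sums of nonnegative terms are summable. Conversely, a finite set whose
  sum is within \<open>\<epsilon> powr p / 2\<close> of the total leaves at most that much to any
  disjoint finite set; the half makes the final inequality strict.\<close>

lemma fvanish_iff_summable_on:
  assumes p: "p \<ge> 1" and v: "\<And>j. 0 \<le> v j"
  shows "fvanish p v \<longleftrightarrow> (\<lambda>j. v j powr p) summable_on UNIV"
proof
  assume "fvanish p v"
  then have "bdd_above ((\<lambda>F. fnorm p F v) ` {F. finite F})"
    using p v by (intro fvanish_bdd_above) auto
  then obtain C where C: "\<And>F. finite F \<Longrightarrow> fnorm p F v \<le> C"
    unfolding bdd_above_def by auto
  have "(\<Sum>j\<in>F. v j powr p) \<le> C powr p" if "finite F" for F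
    using C[OF that] p fnorm_nonneg[OF that, of p v] fnorm_powr[OF p, of F v]
    by (metis order_trans powr_mono2 zero_le_one)
  then have "bdd_above (sum (\<lambda>j. v j powr p) ` {F. F \<subseteq> UNIV \<and> finite F})"
    by (intro bdd_aboveI2[where M = "C powr p"]) auto
  then show "(\<lambda>j. v j powr p) summable_on UNIV"
    by (intro nonneg_bdd_above_summable_on) auto
next
  assume S: "(\<lambda>j. v j powr p) summable_on UNIV"
  show "fvanish p v"
    unfolding fvanish_def
  proof (intro allI impI)
    fix \<epsilon> :: real assume e: "\<epsilon> > 0"
    then have e': "\<epsilon> powr p / 2 > 0" by simp
    obtain F where F: "finite F" "dist (\<Sum>j\<in>F. v j powr p) (\<Sum>\<^sub>\<infinity>j. v j powr p) \<le> \<epsilon> powr p / 2"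
      using infsum_finite_approximation[OF S e'] by auto
    have "fnorm p G v < \<epsilon>" if G: "finite G" "G \<inter> F = {}" for G
    proof -
      have "(\<Sum>j\<in>G. v j powr p) + (\<Sum>j\<in>F. v j powr p) = (\<Sum>j\<in>G \<union> F. v j powr p)"
        using G F(1) by (simp add: sum.union_disjoint)
      also have "\<dots> \<le> (\<Sum>\<^sub>\<infinity>j. v j powr p)"
        using G F(1) by (intro finite_sum_le_infsum[OF S]) auto
      finally have "(\<Sum>j\<in>G. v j powr p) \<le> \<epsilon> powr p / 2"
        using F(2) unfolding dist_real_def by linarith
      then have "fnorm p G v powr p < \<epsilon> powr p"
        using e' unfolding fnorm_powr[OF p] by linarith
      then show ?thesis
        using p e powr_mono2[of p \<epsilon> "fnorm p G v"] by force
    qed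
    then show "\<exists>F. finite F \<and> (\<forall>G. finite G \<longrightarrow> G \<inter> F = {} \<longrightarrow> fnorm p G v < \<epsilon>)"
      using F(1) by blast
  qed
qed

lemma lnorm_eq_infsum:
  assumes p: "p \<ge> 1" and v: "\<And>j. 0 \<le> v j" and S: "(\<lambda>j. v j powr p) summable_on UNIV"
  shows "lnorm p v = (\<Sum>\<^sub>\<infinity>j. v j powr p) powr (1 / p)"
proof (rule antisym)
  show "lnorm p v \<le> (\<Sum>\<^sub>\<infinity>j. v j powr p) powr (1 / p)"
    using p by (intro lnorm_le)
      (auto simp: fnorm_def intro!: powr_mono2 sum_nonneg finite_sum_le_infsum[OF S])
  have van: "fvanish p v" using fvanish_iff_summable_on[OF p, of v] v S by blast
  have "(\<Sum>\<^sub>\<infinity>j. v j powr p) \<le> lnorm p v powr p"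
  proof (rule infsum_le_finite_sums[OF S])
    fix F :: "'a set" assume "finite F" "F \<subseteq> UNIV"
    then show "(\<Sum>j\<in>F. v j powr p) \<le> lnorm p v powr p"
      unfolding fnorm_powr[OF p, symmetric]
      using p v van by (intro powr_mono2 fnorm_le_lnorm fnorm_nonneg) auto
  qed
  then have "(\<Sum>\<^sub>\<infinity>j. v j powr p) powr (1 / p) \<le> (lnorm p v powr p) powr (1 / p)"
    using p by (intro powr_mono2) (auto intro: infsum_nonneg)
  moreover have "0 \<le> lnorm p v"
    using fnorm_le_lnorm[of p v "{}"] p v van by simp
  ultimately show "(\<Sum>\<^sub>\<infinity>j. v j powr p) powr (1 / p) \<le> lnorm p v"
    using p by (simp add: powr_powr)
qed

lemma lnorm_0_eq_SUP:
  assumes v: "\<And>j. 0 \<le> v j" and van: "fvanish 0 v"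
  shows "lnorm 0 v = (SUP j. v j)"
proof (rule antisym)
  have le: "v j \<le> lnorm 0 v" for j
    using fnorm_le_lnorm[of 0 v "{j}"] fnorm_0_ge[of "{j}" j v] v van by simp
  then have bdd: "bdd_above (range v)" by (intro bdd_aboveI2) auto
  have "0 \<le> (SUP j. v j)" using v bdd by (meson UNIV_I cSUP_upper order_trans)
  then show "lnorm 0 v \<le> (SUP j. v j)"
    using bdd by (intro lnorm_le fnorm_0_le) (auto intro: cSUP_upper)
  show "(SUP j. v j) \<le> lnorm 0 v" using le by (intro cSUP_least) auto
qed

subsection \<open>Koethe spaces as metric spaces\<close>

text \<open>Every finite set of integers lies in some \<open>{-N..N}\<close>, so the filter is the
  cofinite one. This brings the limit in the \<open>p = 0\<close> space into the shape of
  \<open>fvanish_0_iff\<close>.\<close>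

lemma eventually_abs_at_top_int:
  "eventually P (filtercomap (\<lambda>j::int. \<bar>j\<bar>) at_top) \<longleftrightarrow> (\<exists>F. finite F \<and> (\<forall>j. j \<notin> F \<longrightarrow> P j))"
proof
  assume "eventually P (filtercomap (\<lambda>j::int. \<bar>j\<bar>) at_top)"
  then obtain N where N: "\<And>j. \<bar>j\<bar> \<ge> N \<Longrightarrow> P j"
    by (auto simp: eventually_filtercomap_at_top_linorder)
  have "P j" if "j \<notin> {-N..N}" for j using that by (intro N) auto
  then show "\<exists>F. finite F \<and> (\<forall>j. j \<notin> F \<longrightarrow> P j)" by blast
next
  assume "\<exists>F. finite F \<and> (\<forall>j. j \<notin> F \<longrightarrow> P j)"
  then obtain F where F: "finite F" "\<And>j. j \<notin> F \<Longrightarrow> P j" by blast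
  have "P j" if "\<bar>j\<bar> \<ge> Max (insert 0 (abs ` F)) + 1" for j
  proof (rule F(2), rule notI)
    assume "j \<in> F"
    then have "\<bar>j\<bar> \<le> Max (insert 0 (abs ` F))" using F(1) by (intro Max_ge) auto
    then show False using that by simp
  qed
  then show "eventually P (filtercomap (\<lambda>j::int. \<bar>j\<bar>) at_top)"
    by (auto simp: eventually_filtercomap_at_top_linorder)
qed

locale koethe =
  fixes p :: real and a :: "int \<Rightarrow> nat \<Rightarrow> real"
  assumes p: "p = 0 \<or> p \<ge> 1" and matrix: "koethe_matrix a"
begin

abbreviation wt :: "nat \<Rightarrow> (int \<Rightarrow> 'a::{real_normed_field,banach}) \<Rightarrow> int \<Rightarrow> real" where
  "wt k x \<equiv> \<lambda>j. a j k * norm (x j)"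

abbreviation X :: "(int \<Rightarrow> 'a::{real_normed_field,banach}) set" where
  "X \<equiv> koethe_space p a"

abbreviation nrm :: "nat \<Rightarrow> (int \<Rightarrow> 'a::{real_normed_field,banach}) \<Rightarrow> real" where
  "nrm \<equiv> koethe_seminorm p a"

lemma a_nonneg [simp]: "k \<ge> 1 \<Longrightarrow> 0 \<le> a j k"
  using matrix by (simp add: koethe_matrix_def)

lemma a_mono:
  assumes "1 \<le> k" "k \<le> l"
  shows "a j k \<le> a j l"
  using assms(2)
proof (induction l rule: dec_induct)
  case (step n)
  then show ?case using matrix assms(1) unfolding koethe_matrix_def
    by (metis Suc_eq_plus1 le_trans order_trans)
qed simp

lemma a_pos: "\<exists>k\<ge>1. a j k > 0"
  using matrix by (simp add: koethe_matrix_def)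

lemma wt_nonneg: "k \<ge> 1 \<Longrightarrow> 0 \<le> a j k * norm y"
  by simp

lemma norm_scaleR_a: "k \<ge> 1 \<Longrightarrow> norm (a j k *\<^sub>R y) = a j k * norm y"
  by (simp add: a_nonneg)

lemma space_iff: "x \<in> X \<longleftrightarrow> (\<forall>k\<ge>1. fvanish p (wt k x))"
proof (cases "p = 0")
  case True
  have "((\<lambda>j. a j k *\<^sub>R x j) \<longlongrightarrow> 0) (filtercomap (\<lambda>j. \<bar>j\<bar>) at_top) \<longleftrightarrow> fvanish 0 (wt k x)"
    if k: "k \<ge> 1" for k
  proof -
    have "((\<lambda>j. a j k *\<^sub>R x j) \<longlongrightarrow> 0) (filtercomap (\<lambda>j. \<bar>j\<bar>) at_top) \<longleftrightarrow>
        (\<forall>\<epsilon>>0. \<exists>F. finite F \<and> (\<forall>j. j \<notin> F \<longrightarrow> norm (a j k *\<^sub>R x j) < \<epsilon>))"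
      unfolding tendsto_iff eventually_abs_at_top_int dist_norm by simp
    then show ?thesis
      unfolding norm_scaleR_a[OF k] by (subst fvanish_0_iff) (use k in \<open>simp_all add: wt_nonneg\<close>)
  qed
  then show ?thesis using True by (auto simp: koethe_space_def)
next
  case False
  then have p1: "p \<ge> 1" using p by simp
  have "(\<lambda>j. norm (a j k *\<^sub>R x j) powr p) summable_on UNIV \<longleftrightarrow> fvanish p (wt k x)"
    if k: "k \<ge> 1" for k
    unfolding norm_scaleR_a[OF k] by (rule fvanish_iff_summable_on[OF p1, symmetric]) (rule wt_nonneg[OF k])
  then show ?thesis using False by (auto simp: koethe_space_def)
qed

lemma nrm_eq:
  assumes "x \<in> X" and k: "k \<ge> 1"
  shows "nrm k x = lnorm p (wt k x)"
proof -
  have van: "fvanish p (wt k x)" using assms space_iff by blast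
  have nn: "0 \<le> wt k x j" for j by (rule wt_nonneg[OF k])
  show ?thesis
  proof (cases "p = 0")
    case True
    then show ?thesis
      unfolding koethe_seminorm_def norm_scaleR_a[OF k]
      using lnorm_0_eq_SUP[of "wt k x", OF nn] van by simp
  next
    case False
    then have p1: "p \<ge> 1" using p by simp
    then show ?thesis
      unfolding koethe_seminorm_def norm_scaleR_a[OF k] using False
      using lnorm_eq_infsum[OF p1, of "wt k x", OF nn] van
        fvanish_iff_summable_on[OF p1, of "wt k x", OF nn] by simp
  qed
qed

lemma fnorm_le_nrm:
  assumes "x \<in> X" "k \<ge> 1" "finite F"
  shows "fnorm p F (wt k x) \<le> nrm k x"
  unfolding nrm_eq[OF assms(1,2)] using assms space_iff
  by (intro fnorm_le_lnorm p wt_nonneg) auto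

lemma nrm_leI:
  assumes "x \<in> X" "k \<ge> 1" "\<And>F. finite F \<Longrightarrow> fnorm p F (wt k x) \<le> C"
  shows "nrm k x \<le> C"
  unfolding nrm_eq[OF assms(1,2)] using assms(3) by (rule lnorm_le)

lemma nrm_nonneg: "x \<in> X \<Longrightarrow> k \<ge> 1 \<Longrightarrow> 0 \<le> nrm k x"
  using fnorm_le_nrm[of x k "{}"] by simp

lemma wt_le_nrm:
  assumes "x \<in> X" "k \<ge> 1"
  shows "wt k x j \<le> nrm k x"
  using fnorm_ge[OF p, of "{j}" j "wt k x"] fnorm_le_nrm[OF assms, of "{j}"] wt_nonneg[OF assms(2), of j "x j"]
  by simp

lemma nrm_mono_index:
  assumes "x \<in> X" "1 \<le> k" "k \<le> l"
  shows "nrm k x \<le> nrm l x"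
proof (rule nrm_leI)
  fix F :: "int set" assume F: "finite F"
  have "fnorm p F (wt k x) \<le> fnorm p F (wt l x)"
    using assms F by (intro fnorm_mono[OF p]) (auto intro!: mult_right_mono a_mono wt_nonneg)
  also have "\<dots> \<le> nrm l x" using assms F by (intro fnorm_le_nrm) auto
  finally show "fnorm p F (wt k x) \<le> nrm l x" .
qed (use assms in auto)

lemma space_solid:
  assumes "y \<in> X" "\<And>j. norm (x j) \<le> norm (y j)"
  shows "x \<in> X"
  unfolding space_iff
proof (intro allI impI)
  fix k :: nat assume k: "k \<ge> 1"
  show "fvanish p (wt k x)"
    by (rule fvanish_mono[OF p, of "wt k x" "wt k y"])
      (use assms k space_iff[of y] in \<open>auto intro!: mult_left_mono wt_nonneg\<close>)
qed

lemma nrm_solid: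
  assumes "y \<in> X" "k \<ge> 1" "\<And>j. norm (x j) \<le> norm (y j)"
  shows "nrm k x \<le> nrm k y"
proof (rule nrm_leI)
  fix F :: "int set" assume F: "finite F"
  have "fnorm p F (wt k x) \<le> fnorm p F (wt k y)"
    using assms F by (intro fnorm_mono[OF p]) (auto intro!: mult_left_mono wt_nonneg)
  also have "\<dots> \<le> nrm k y" using assms F by (intro fnorm_le_nrm) auto
  finally show "fnorm p F (wt k x) \<le> nrm k y" .
qed (use assms space_solid in auto)

lemma space_finite_support:
  assumes "finite F" "\<And>j. j \<notin> F \<Longrightarrow> x j = 0"
  shows "x \<in> X"
  unfolding space_iff using assms by (intro allI impI fvanish_finite_support[OF p assms(1)]) simp

lemma nrm_finite_support:
  assumes "finite F" "\<And>j. j \<notin> F \<Longrightarrow> x j = 0" "k \<ge> 1"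
  shows "nrm k x = fnorm p F (wt k x)"
proof -
  have "x \<in> X" using assms(1,2) by (rule space_finite_support)
  then show ?thesis
    unfolding nrm_eq[OF \<open>x \<in> X\<close> assms(3)]
    by (intro lnorm_finite_support[OF p _ assms(1)] wt_nonneg[OF assms(3)]) (simp add: assms(2))
qed

lemma space_zero: "(\<lambda>j. 0) \<in> X"
  by (rule space_finite_support[of "{}"]) auto

lemma space_scale:
  assumes "x \<in> X"
  shows "(\<lambda>j. c * x j) \<in> X"
  unfolding space_iff
proof (intro allI impI)
  fix k :: nat assume k: "k \<ge> 1"
  show "fvanish p (wt k (\<lambda>j. c * x j))"
    unfolding fvanish_def
  proof (intro allI impI)
    fix \<epsilon> :: real assume e: "\<epsilon> > 0"
    \<comment> \<open>Adding 1 covers the case \<open>c = 0\<close>.\<close>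
    then have "\<epsilon> / (norm c + 1) > 0" by (simp add: add_nonneg_pos)
    then obtain F where F: "finite F"
      "\<And>G. finite G \<Longrightarrow> G \<inter> F = {} \<Longrightarrow> fnorm p G (wt k x) < \<epsilon> / (norm c + 1)"
      using assms k unfolding space_iff fvanish_def by metis
    have "fnorm p G (wt k (\<lambda>j. c * x j)) < \<epsilon>" if G: "finite G" "G \<inter> F = {}" for G
    proof -
      have "fnorm p G (wt k (\<lambda>j. c * x j)) = fnorm p G (\<lambda>j. norm c * wt k x j)"
        by (rule fnorm_cong) (auto simp: norm_mult)
      also have "\<dots> = norm c * fnorm p G (wt k x)"
        using k by (intro fnorm_scale[OF p G(1)] wt_nonneg) auto
      also have "\<dots> \<le> (norm c + 1) * fnorm p G (wt k x)"
        using fnorm_nonneg[OF G(1)] by (intro mult_right_mono) auto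
      also have "\<dots> < (norm c + 1) * (\<epsilon> / (norm c + 1))"
        using F(2)[OF G] by (intro mult_strict_left_mono) (auto simp: add_nonneg_pos)
      also have "\<dots> = \<epsilon>"
        by (simp add: add_nonneg_eq_0_iff)
      finally show ?thesis .
    qed
    then show "\<exists>F. finite F \<and> (\<forall>G. finite G \<longrightarrow> G \<inter> F = {} \<longrightarrow> fnorm p G (wt k (\<lambda>j. c * x j)) < \<epsilon>)"
      using F(1) by blast
  qed
qed

lemma nrm_scale_le:
  assumes "x \<in> X" "k \<ge> 1"
  shows "nrm k (\<lambda>j. c * x j) \<le> norm c * nrm k x"
proof (rule nrm_leI[OF space_scale[OF assms(1)] assms(2)])
  fix F :: "int set" assume F: "finite F"
  have "fnorm p F (wt k (\<lambda>j. c * x j)) = fnorm p F (\<lambda>j. norm c * wt k x j)"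
    by (rule fnorm_cong) (auto simp: norm_mult)
  also have "\<dots> = norm c * fnorm p F (wt k x)"
    using assms by (intro fnorm_scale[OF p F] wt_nonneg) auto
  also have "\<dots> \<le> norm c * nrm k x"
    using assms F by (intro mult_left_mono fnorm_le_nrm) auto
  finally show "fnorm p F (wt k (\<lambda>j. c * x j)) \<le> norm c * nrm k x" .
qed

text \<open>For \<open>c \<noteq> 0\<close> the missing inequality is \<open>nrm_scale_le\<close>
  for the factor \<open>inverse c\<close> and the vector \<open>c * x\<close>.\<close>

lemma nrm_scale:
  assumes "x \<in> X" "k \<ge> 1"
  shows "nrm k (\<lambda>j. c * x j) = norm c * nrm k x"
proof (cases "c = 0")
  case True
  then show ?thesis
    using nrm_scale_le[OF assms, of c] nrm_nonneg[OF space_scale[OF assms(1)] assms(2), of c] by simp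
next
  case False
  have "nrm k x \<le> norm (inverse c) * nrm k (\<lambda>j. c * x j)"
    using nrm_scale_le[OF space_scale[OF assms(1)] assms(2), of "inverse c" c] False
    by (simp flip: mult.assoc)
  then have "norm c * nrm k x \<le> norm c * (norm (inverse c) * nrm k (\<lambda>j. c * x j))"
    by (rule mult_left_mono) simp
  also have "\<dots> = nrm k (\<lambda>j. c * x j)"
    using False by (simp flip: mult.assoc norm_mult)
  finally have "norm c * nrm k x \<le> nrm k (\<lambda>j. c * x j)" .
  then show ?thesis using nrm_scale_le[OF assms, of c] by simp
qed

lemma space_diff:
  assumes "x \<in> X" "y \<in> X"
  shows "(\<lambda>j. x j - y j) \<in> X"
  unfolding space_iff
proof (intro allI impI)
  fix k :: nat assume k: "k \<ge> 1"
  have "fvanish p (\<lambda>j. wt k x j + wt k y j)"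
    using assms k wt_nonneg[OF k] by (intro fvanish_add[OF p]) (auto simp: space_iff)
  then show "fvanish p (wt k (\<lambda>j. x j - y j))"
    by (rule fvanish_mono[OF p, rotated -1])
      (use wt_nonneg[OF k] a_nonneg[OF k] in
        \<open>auto simp flip: distrib_left intro!: mult_left_mono norm_triangle_ineq4\<close>)
qed

lemma nrm_diff_le:
  assumes "x \<in> X" "y \<in> X" "k \<ge> 1"
  shows "nrm k (\<lambda>j. x j - y j) \<le> nrm k x + nrm k y"
proof (rule nrm_leI[OF space_diff[OF assms(1,2)] assms(3)])
  fix F :: "int set" assume F: "finite F"
  have "fnorm p F (wt k (\<lambda>j. x j - y j)) \<le> fnorm p F (\<lambda>j. wt k x j + wt k y j)"
    using a_nonneg[OF assms(3)] F
    by (intro fnorm_mono[OF p]) (auto simp flip: distrib_left intro!: mult_left_mono norm_triangle_ineq4)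
  also have "\<dots> \<le> fnorm p F (wt k x) + fnorm p F (wt k y)"
    using wt_nonneg[OF assms(3)] by (intro fnorm_triangle[OF p F]) auto
  also have "\<dots> \<le> nrm k x + nrm k y"
    using assms F by (intro add_mono fnorm_le_nrm) auto
  finally show "fnorm p F (wt k (\<lambda>j. x j - y j)) \<le> nrm k x + nrm k y" .
qed

lemma nrm_truncate:
  assumes "x \<in> X" "k \<ge> 1" "c < nrm k x"
  obtains F where "finite F" "\<And>G. finite G \<Longrightarrow> F \<subseteq> G \<Longrightarrow> c < fnorm p G (wt k x)"
proof -
  have "fvanish p (wt k x)" using assms space_iff by blast
  moreover have "c < lnorm p (wt k x)" using assms(3) unfolding nrm_eq[OF assms(1,2)] .
  ultimately obtain F where F: "finite F" "c < fnorm p F (wt k x)"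
    using less_lnormE[OF p, of "wt k x"] wt_nonneg[OF assms(2)] by blast
  have "c < fnorm p G (wt k x)" if G: "finite G" "F \<subseteq> G" for G
    by (rule less_le_trans[OF F(2) fnorm_mono[OF p G]]) (rule wt_nonneg[OF assms(2)], rule order_refl)
  with F(1) show ?thesis by (rule that)
qed

text \<open>The coordinates are assumed to add up in absolute value, as nonnegative ones do. The
  weighted coordinates of \<open>x\<close> are then sums of nonnegative families, and no convergence
  in the metric has to be discussed.\<close>

lemma space_sums:
  assumes z: "\<And>n. z n \<in> X" and sm: "\<And>k. k \<ge> 1 \<Longrightarrow> summable (\<lambda>n. nrm k (z n))"
    and x: "\<And>j. (\<lambda>n. norm (z n j)) sums norm (x j)"
  shows "x \<in> X"
  unfolding space_iff
proof (intro allI impI)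
  fix k :: nat assume k: "k \<ge> 1"
  show "fvanish p (wt k x)"
  proof (rule fvanish_sums[OF p, of "\<lambda>n. wt k (z n)"])
    show "summable (\<lambda>n. lnorm p (wt k (z n)))" using sm[OF k] unfolding nrm_eq[OF z k] .
    show "fvanish p (wt k (z n))" for n using z[of n] k by (simp add: space_iff)
    show "(\<lambda>n. wt k (z n) j) sums wt k x j" for j by (rule sums_mult[OF x])
  qed (rule wt_nonneg[OF k])
qed

lemma nrm_sums_le:
  assumes z: "\<And>n. z n \<in> X" and k: "k \<ge> 1" and sm: "summable (\<lambda>n. nrm k (z n))"
    and "x \<in> X" and x: "\<And>j. (\<lambda>n. norm (z n j)) sums norm (x j)"
  shows "nrm k x \<le> (\<Sum>n. nrm k (z n))"
proof -
  have "lnorm p (wt k x) \<le> (\<Sum>n. lnorm p (wt k (z n)))"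
  proof (rule lnorm_sums_le[OF p])
    show "summable (\<lambda>n. lnorm p (wt k (z n)))" using sm unfolding nrm_eq[OF z k] .
    show "fvanish p (wt k (z n))" for n using z[of n] k by (simp add: space_iff)
    show "(\<lambda>n. wt k (z n) j) sums wt k x j" for j by (rule sums_mult[OF x])
  qed (rule wt_nonneg[OF k])
  then show ?thesis unfolding nrm_eq[OF z k] nrm_eq[OF \<open>x \<in> X\<close> k] .
qed

section \<open>The metric and its seminorm estimates\<close>

text \<open>The distance from \<open>v\<close> to zero. The metric is translation invariant, so it
  is determined by this function of the difference.\<close>

definition gauge :: "(int \<Rightarrow> 'a::{real_normed_field,banach}) \<Rightarrow> real" where
  "gauge v = (\<Sum>k. (1 / 2) ^ Suc k * min 1 (nrm (Suc k) v))"

lemma dist_eq_gauge: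
  "x \<in> X \<Longrightarrow> y \<in> X \<Longrightarrow> koethe_dist p a x y = gauge (\<lambda>j. x j - y j)"
  by (simp add: koethe_dist_def gauge_def)

lemma summable_half_powers: "summable (\<lambda>k. (1 / 2 :: real) ^ Suc k)"
  using summable_geometric[of "1 / 2 :: real"] by (simp add: summable_mult)

lemma summable_gauge:
  assumes "v \<in> X"
  shows "summable (\<lambda>k. (1 / 2) ^ Suc k * min 1 (nrm (Suc k) v))"
proof (rule summable_comparison_test[OF _ summable_half_powers])
  have "norm ((1 / 2) ^ Suc k * min 1 (nrm (Suc k) v)) \<le> (1 / 2) ^ Suc k" for k
    using nrm_nonneg[OF assms, of "Suc k"] mult_left_mono[of "min 1 (nrm (Suc k) v)" 1 "(1 / 2) ^ Suc k"]
    by (simp add: abs_mult)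
  then show "\<exists>N. \<forall>n\<ge>N. norm ((1 / 2) ^ Suc n * min 1 (nrm (Suc n) v)) \<le> (1 / 2) ^ Suc n" by blast
qed

lemma gauge_nonneg:
  assumes "v \<in> X"
  shows "0 \<le> gauge v"
  unfolding gauge_def using nrm_nonneg[OF assms]
  by (intro suminf_nonneg summable_gauge[OF assms]) auto

text \<open>A single term of the series. Together with \<open>gauge_le\<close> it converts between
  small distances and small seminorms; the cap at 1 has to be carried along.\<close>

lemma gauge_ge:
  assumes "v \<in> X" "q \<ge> 1"
  shows "(1 / 2) ^ q * min 1 (nrm q v) \<le> gauge v"
proof -
  obtain k where q: "q = Suc k" using assms(2) by (cases q) auto
  have "(\<Sum>n\<in>{k}. (1 / 2) ^ Suc n * min 1 (nrm (Suc n) v)) \<le> gauge v"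
    unfolding gauge_def using nrm_nonneg[OF assms(1)]
    by (intro sum_le_suminf summable_gauge[OF assms(1)]) auto
  then show ?thesis by (simp add: q)
qed

text \<open>The series is cut after \<open>q\<close> terms: the leading seminorms are at most
  \<open>nrm q v\<close> and their weights sum to at most 1, while the tail has total weight
  \<open>(1 / 2) ^ q\<close>.\<close>

lemma gauge_le:
  assumes v: "v \<in> X" and q: "q \<ge> 1"
  shows "gauge v \<le> nrm q v + (1 / 2) ^ q"
proof -
  let ?f = "\<lambda>k. (1 / 2) ^ Suc k * min 1 (nrm (Suc k) v)"
  have "gauge v = (\<Sum>k. ?f (k + q)) + (\<Sum>k<q. ?f k)"
    unfolding gauge_def by (rule suminf_split_initial_segment[OF summable_gauge[OF v]])
  also have "(\<Sum>k. ?f (k + q)) \<le> (\<Sum>k. (1 / 2) ^ Suc (k + q))"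
  proof (rule suminf_le)
    show "?f (k + q) \<le> (1 / 2) ^ Suc (k + q)" for k
      using mult_left_mono[of "min 1 (nrm (Suc (k + q)) v)" 1 "(1 / 2) ^ Suc (k + q)"] by simp
    show "summable (\<lambda>k. ?f (k + q))"
      by (rule summable_ignore_initial_segment[OF summable_gauge[OF v]])
    show "summable (\<lambda>k. (1 / 2 :: real) ^ Suc (k + q))"
      by (rule summable_ignore_initial_segment[OF summable_half_powers])
  qed
  also have "(\<Sum>k. (1 / 2 :: real) ^ Suc (k + q)) = (1 / 2) ^ q"
    using sums_unique[OF sums_mult[OF power_half_series, of "(1 / 2) ^ q"]]
    by (simp add: power_add mult.commute mult.left_commute)
  also have "(\<Sum>k<q. ?f k) \<le> (\<Sum>k<q. (1 / 2) ^ Suc k * nrm q v)"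
  proof (rule sum_mono)
    fix k assume "k \<in> {..<q}"
    then have "nrm (Suc k) v \<le> nrm q v" by (intro nrm_mono_index v) auto
    then show "?f k \<le> (1 / 2) ^ Suc k * nrm q v" by (intro mult_left_mono) auto
  qed
  also have "\<dots> = (\<Sum>k<q. (1 / 2) ^ Suc k) * nrm q v" by (simp add: sum_distrib_right)
  also have "\<dots> \<le> 1 * nrm q v"
  proof (rule mult_right_mono)
    have "(\<Sum>k<q. (1 / 2 :: real) ^ Suc k) \<le> (\<Sum>k. (1 / 2) ^ Suc k)"
      by (rule sum_le_suminf[OF summable_half_powers]) auto
    then show "(\<Sum>k<q. (1 / 2 :: real) ^ Suc k) \<le> 1"
      using sums_unique[OF power_half_series] by simp
  qed (use nrm_nonneg v q in auto)
  finally show ?thesis by simp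
qed

lemma gauge_triangle:
  assumes "x \<in> X" "y \<in> X"
  shows "gauge (\<lambda>j. x j - y j) \<le> gauge x + gauge y"
proof -
  have "gauge (\<lambda>j. x j - y j) \<le>
      (\<Sum>k. (1 / 2) ^ Suc k * min 1 (nrm (Suc k) x) + (1 / 2) ^ Suc k * min 1 (nrm (Suc k) y))"
    unfolding gauge_def
  proof (rule suminf_le)
    fix k
    have "nrm (Suc k) (\<lambda>j. x j - y j) \<le> nrm (Suc k) x + nrm (Suc k) y"
      using assms by (intro nrm_diff_le) auto
    then have "min 1 (nrm (Suc k) (\<lambda>j. x j - y j)) \<le> min 1 (nrm (Suc k) x) + min 1 (nrm (Suc k) y)"
      using nrm_nonneg[OF assms(1), of "Suc k"] nrm_nonneg[OF assms(2), of "Suc k"] by linarith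
    then show "(1 / 2) ^ Suc k * min 1 (nrm (Suc k) (\<lambda>j. x j - y j)) \<le>
        (1 / 2) ^ Suc k * min 1 (nrm (Suc k) x) + (1 / 2) ^ Suc k * min 1 (nrm (Suc k) y)"
      unfolding distrib_left[symmetric] by (rule mult_left_mono) simp
  qed (intro summable_add summable_gauge assms space_diff)+
  also have "\<dots> = gauge x + gauge y"
    unfolding gauge_def by (rule suminf_add[symmetric]) (intro summable_gauge assms)+
  finally show ?thesis .
qed

lemma gauge_cong_norm:
  assumes "\<And>j. norm (x j) = norm (y j)"
  shows "gauge x = gauge y"
  unfolding gauge_def koethe_seminorm_def norm_scaleR assms ..

lemma gauge_eq_0:
  assumes "v \<in> X" "gauge v = 0"
  shows "v j = 0"
proof -
  \<comment> \<open>Each coordinate is seen by some seminorm; this is where the positivity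
    requirement on the matrix makes the metric separate points.\<close>
  obtain k where k: "k \<ge> 1" "a j k > 0" using a_pos by blast
  have "(1 / 2) ^ k * min 1 (nrm k v) \<le> 0" using gauge_ge[OF assms(1) k(1)] assms(2) by simp
  then have "min 1 (nrm k v) \<le> 0"
    using zero_less_power[of "1 / 2 :: real" k] by (simp only: mult_le_0_iff) linarith
  then have "wt k v j \<le> 0" using wt_le_nrm[OF assms(1) k(1), of j] by linarith
  then show ?thesis using k(2) by (simp add: mult_le_0_iff)
qed

lemma gauge_zero: "gauge (\<lambda>j. 0 :: 'a::{real_normed_field,banach}) = 0"
proof -
  have "nrm (Suc k) (\<lambda>j. 0 :: 'a) = 0" for k
    by (subst nrm_finite_support[of "{}"]) auto
  then show ?thesis by (simp add: gauge_def)
qed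

lemma Metric_space_koethe:
  "Metric_space (X :: (int \<Rightarrow> 'a::{real_normed_field,banach}) set) (koethe_dist p a)"
proof
  fix x y z :: "int \<Rightarrow> 'a"
  show "0 \<le> koethe_dist p a x y"
    using gauge_nonneg[OF space_diff, of x y] by (cases "x \<in> X \<and> y \<in> X") (auto simp: dist_eq_gauge, auto simp: koethe_dist_def)
  show "koethe_dist p a x y = koethe_dist p a y x"
    using gauge_cong_norm[of "\<lambda>j. x j - y j" "\<lambda>j. y j - x j"]
    by (cases "x \<in> X \<and> y \<in> X") (auto simp: dist_eq_gauge norm_minus_commute, auto simp: koethe_dist_def)
  assume xy: "x \<in> X" "y \<in> X"
  show "koethe_dist p a x y = 0 \<longleftrightarrow> x = y"
    using gauge_eq_0[OF space_diff[OF xy]] gauge_zero by (auto simp: dist_eq_gauge xy)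
  assume z: "z \<in> X"
  \<comment> \<open>\<open>gauge_triangle\<close> is stated for differences, so \<open>x - z\<close>
    is written as \<open>(x - y) - (z - y)\<close>.\<close>
  have "gauge (\<lambda>j. (x j - y j) - (z j - y j)) \<le> gauge (\<lambda>j. x j - y j) + gauge (\<lambda>j. z j - y j)"
    by (intro gauge_triangle space_diff xy z)
  moreover have "gauge (\<lambda>j. z j - y j) = gauge (\<lambda>j. y j - z j)"
    by (rule gauge_cong_norm) (simp add: norm_minus_commute)
  ultimately show "koethe_dist p a x z \<le> koethe_dist p a x y + koethe_dist p a y z"
    by (simp add: dist_eq_gauge xy z)
qed

end

subsection \<open>Sets of upper density one\<close>

text \<open>Upper density one, expressed by the proportion of exceptions dropping below any
  \<open>c\<close> at arbitrarily late \<open>N\<close>. Counting exceptions allows union bounds and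
  avoids limits in \<open>ereal\<close>.\<close>

definition full :: "nat set \<Rightarrow> bool" where
  "full S \<longleftrightarrow> (\<forall>c>0. \<forall>M. \<exists>N\<ge>M. real (card ({1..N} - S)) < c * real N)"

lemma fullD:
  assumes "full S" "c > 0"
  obtains N where "N \<ge> M" "real (card ({1..N} - S)) < c * real N"
  using assms unfolding full_def by blast

text \<open>With the next lemma, this turns both clauses of distributional chaos into statements
  about \<open>full\<close> sets.\<close>

lemma liminf_frequency_eq_0_iff:
  "liminf (\<lambda>N. ereal (real (card ({1..N} \<inter> S)) / real N)) = 0 \<longleftrightarrow> full (- S)"
proof -
  let ?f = "\<lambda>N. real (card ({1..N} \<inter> S)) / real N"
  have ge: "0 \<le> liminf (\<lambda>N. ereal (?f N))"
    by (rule Liminf_bounded) (simp add: always_eventually)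
  have compl: "{1..N} - - S = {1..N} \<inter> S" for N by auto
  show ?thesis
  proof
    assume L: "liminf (\<lambda>N. ereal (?f N)) = 0"
    show "full (- S)"
      unfolding full_def compl
    proof (intro allI impI)
      fix c :: real and M :: nat assume c: "c > 0"
      show "\<exists>N\<ge>M. real (card ({1..N} \<inter> S)) < c * real N"
      proof (rule ccontr)
        assume neg: "\<not> ?thesis"
        have "ereal c \<le> ereal (?f N)" if "N \<ge> max M 1" for N
        proof -
          have "c * real N \<le> real (card ({1..N} \<inter> S))" using neg that by (meson max.bounded_iff not_le)
          then show ?thesis using that by (simp add: pos_le_divide_eq)
        qed
        then have "eventually (\<lambda>N. ereal c \<le> ereal (?f N)) sequentially"
          unfolding eventually_sequentially by blast
        then have "ereal c \<le> liminf (\<lambda>N. ereal (?f N))" by (rule Liminf_bounded)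
        then show False using L c by simp
      qed
    qed
  next
    assume F: "full (- S)"
    have "\<not> 0 < liminf (\<lambda>N. ereal (?f N))"
    proof
      assume "0 < liminf (\<lambda>N. ereal (?f N))"
      then obtain c where c: "0 < ereal c" "ereal c < liminf (\<lambda>N. ereal (?f N))"
        using ereal_dense2 by blast
      then have "eventually (\<lambda>N. ereal c < ereal (?f N)) sequentially"
        using less_LiminfD by blast
      then obtain M where M: "\<And>N. N \<ge> M \<Longrightarrow> c < ?f N"
        by (auto simp: eventually_sequentially)
      obtain N where N: "N \<ge> max M 1" "real (card ({1..N} \<inter> S)) < c * real N"
        using fullD[OF F, of c "max M 1"] c(1) unfolding compl by auto
      have "?f N < c" using N by (simp add: pos_divide_less_eq)
      then show False using M[of N] N(1) by simp
    qed
    then show "liminf (\<lambda>N. ereal (?f N)) = 0" using ge unfolding not_less by (rule antisym)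
  qed
qed

lemma limsup_frequency_eq_1_iff:
  "limsup (\<lambda>N. ereal (real (card ({1..N} \<inter> S)) / real N)) = 1 \<longleftrightarrow> full S"
proof -
  let ?f = "\<lambda>N. real (card ({1..N} \<inter> S)) / real N"
  have card: "real (card ({1..N} \<inter> S)) = real N - real (card ({1..N} - S))" for N
  proof -
    have "card {1..N} = card ({1..N} \<inter> S) + card ({1..N} - S)"
      by (rule card_Int_Diff) simp
    then show ?thesis by simp
  qed
  have "?f N \<le> 1" for N
    by (cases "N = 0") (simp_all add: pos_divide_le_eq card[simplified])
  then have le: "limsup (\<lambda>N. ereal (?f N)) \<le> 1"
    by (intro Limsup_bounded) (simp add: always_eventually)
  show ?thesis
  proof
    assume L: "limsup (\<lambda>N. ereal (?f N)) = 1"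
    show "full S"
      unfolding full_def
    proof (intro allI impI)
      fix c :: real and M :: nat assume c: "c > 0"
      show "\<exists>N\<ge>M. real (card ({1..N} - S)) < c * real N"
      proof (rule ccontr)
        assume neg: "\<not> ?thesis"
        have "ereal (?f N) \<le> ereal (1 - c)" if "N \<ge> max M 1" for N
        proof -
          have "c * real N \<le> real (card ({1..N} - S))" using neg that by (meson max.bounded_iff not_le)
          then have "real (card ({1..N} \<inter> S)) \<le> (1 - c) * real N"
            unfolding card left_diff_distrib by simp
          then show ?thesis using that by (simp add: pos_divide_le_eq)
        qed
        then have "eventually (\<lambda>N. ereal (?f N) \<le> ereal (1 - c)) sequentially"
          unfolding eventually_sequentially by blast
        then have "limsup (\<lambda>N. ereal (?f N)) \<le> ereal (1 - c)" by (rule Limsup_bounded)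
        then show False using L c by simp
      qed
    qed
  next
    assume F: "full S"
    have "\<not> limsup (\<lambda>N. ereal (?f N)) < 1"
    proof
      assume "limsup (\<lambda>N. ereal (?f N)) < 1"
      then obtain c where c: "limsup (\<lambda>N. ereal (?f N)) < ereal c" "ereal c < 1"
        using ereal_dense2 by blast
      then have "eventually (\<lambda>N. ereal (?f N) < ereal c) sequentially"
        using Limsup_lessD by blast
      then obtain M where M: "\<And>N. N \<ge> M \<Longrightarrow> ?f N < c"
        by (auto simp: eventually_sequentially)
      obtain N where N: "N \<ge> max M 1" "real (card ({1..N} - S)) < (1 - c) * real N"
        using fullD[OF F, of "1 - c" "max M 1"] c(2) by auto
      have "c * real N < real (card ({1..N} \<inter> S))"
        using N(2) unfolding card left_diff_distrib by linarith
      then have "c < ?f N" using N(1) by (simp add: pos_less_divide_eq)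
      then show False using M[of N] N(1) by simp
    qed
    then show "limsup (\<lambda>N. ereal (?f N)) = 1" using le unfolding not_less by (intro antisym)
  qed
qed

lemma upper_density_eq_1_iff: "upper_density S = 1 \<longleftrightarrow> full S"
  unfolding upper_density_def by (rule limsup_frequency_eq_1_iff)

lemma full_mono:
  assumes "full S" "\<And>n. n \<in> S \<Longrightarrow> n \<ge> 1 \<Longrightarrow> n \<in> S'"
  shows "full S'"
  unfolding full_def
proof (intro allI impI)
  fix c :: real and M :: nat assume "c > 0"
  then obtain N where N: "N \<ge> M" "real (card ({1..N} - S)) < c * real N"
    using fullD[OF assms(1)] by blast
  have "card ({1..N} - S') \<le> card ({1..N} - S)"
    using assms(2) by (intro card_mono) auto
  then show "\<exists>N\<ge>M. real (card ({1..N} - S')) < c * real N" using N by (intro exI[of _ N]) linarith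
qed

text \<open>The finitely many new exceptions number at most \<open>L\<close>, which is below
  \<open>(c / 2) * N\<close> once \<open>N\<close> is large.\<close>

lemma full_eventually:
  assumes "full S" "eventually (\<lambda>n. n \<in> S \<longrightarrow> n \<in> S') sequentially"
  shows "full S'"
  unfolding full_def
proof (intro allI impI)
  fix c :: real and M :: nat assume c: "c > 0"
  obtain L where L: "\<And>n. n \<ge> L \<Longrightarrow> n \<in> S \<Longrightarrow> n \<in> S'"
    using assms(2) by (auto simp: eventually_sequentially)
  obtain K :: nat where K: "real L < (c / 2) * real K"
    using reals_Archimedean3[of "c / 2"] c by (auto simp: mult.commute)
  obtain N where N: "N \<ge> max M K" "real (card ({1..N} - S)) < (c / 2) * real N"
    using fullD[OF assms(1), of "c / 2" "max M K"] c by auto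
  have "card ({1..N} - S') \<le> card (({1..N} - S) \<union> {..<L})"
    using L by (intro card_mono) (auto simp: not_less)
  also have "\<dots> \<le> card ({1..N} - S) + L"
    using card_Un_le[of "{1..N} - S" "{..<L}"] by simp
  finally have "real (card ({1..N} - S')) < (c / 2) * real N + (c / 2) * real K"
    using N(2) K by linarith
  also have "\<dots> \<le> (c / 2) * real N + (c / 2) * real N"
    using N(1) c by (intro add_left_mono mult_left_mono) auto
  finally show "\<exists>N\<ge>M. real (card ({1..N} - S')) < c * real N" using N(1) by (intro exI[of _ N]) auto
qed

lemma full_shift:
  assumes "full S"
  shows "full {n. n + s \<in> S}"
  unfolding full_def
proof (intro allI impI)
  fix c :: real and M :: nat assume c: "c > 0"
  \<comment> \<open>The window shrinks from \<open>N\<close> to \<open>N - s\<close>. From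
    \<open>N \<ge> 2 * s\<close> follows \<open>N \<le> 2 * (N - s)\<close>, so the proportion of
    exceptions at most doubles.\<close>
  obtain N where N: "N \<ge> max (M + s) (2 * s)" "real (card ({1..N} - S)) < (c / 2) * real N"
    using fullD[OF assms, of "c / 2" "max (M + s) (2 * s)"] c by auto
  have "card ({1..N - s} - {n. n + s \<in> S}) \<le> card ({1..N} - S)"
    by (rule card_inj_on_le[of "\<lambda>n. n + s"]) (use N(1) in auto)
  then have "real (card ({1..N - s} - {n. n + s \<in> S})) < (c / 2) * real N"
    using N(2) by linarith
  also have "\<dots> \<le> (c / 2) * (2 * real (N - s))"
    using c N(1) by (intro mult_left_mono) auto
  finally have "real (card ({1..N - s} - {n. n + s \<in> S})) < c * real (N - s)" by (simp del: of_nat_diff)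
  then show "\<exists>N\<ge>M. real (card ({1..N} - {n. n + s \<in> S})) < c * real N"
    using N(1) by (intro exI[of _ "N - s"] conjI) auto
qed

lemma full_infinite:
  assumes "full S"
  shows "\<exists>n\<ge>M. n \<in> S"
proof (rule ccontr)
  assume "\<not> ?thesis"
  then have "full {}"
    using assms by (intro full_eventually[of S "{}"]) (auto simp: eventually_sequentially)
  then obtain N where "N \<ge> 1" "real (card ({1..N} - {})) < 1 * real N"
    using fullD[of "{}" 1] by auto
  then show False by simp
qed

lemma card_frequency_iff:
  "real (card {n \<in> {1..N}. n \<in> S}) > (1 - c) * real N \<longleftrightarrow> real (card ({1..N} - S)) < c * real N"
proof -
  have "card {1..N} = card ({1..N} \<inter> S) + card ({1..N} - S)"
    by (rule card_Int_Diff) simp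
  moreover have "{n \<in> {1..N}. n \<in> S} = {1..N} \<inter> S" by auto
  ultimately have "real N = real (card ({1..N} \<inter> S)) + real (card ({1..N} - S))"
    "{n \<in> {1..N}. n \<in> S} = {1..N} \<inter> S"
    by (metis card_atLeastAtMost diff_Suc_1 of_nat_add)+
  then show ?thesis by (auto simp: algebra_simps)
qed

text \<open>A diagonal argument: the sets \<open>{n. d n < \<tau>}\<close> shrink with
  \<open>\<tau>\<close>, and \<open>D\<close> follows smaller and smaller thresholds on consecutive
  windows, each so long that everything before it is negligible.\<close>

lemma full_pseudo_intersection:
  fixes d :: "nat \<Rightarrow> real"
  assumes d: "\<And>n. 0 \<le> d n" and full: "\<And>\<tau>. \<tau> > 0 \<Longrightarrow> full {n. d n < \<tau>}"
  obtains D where "D \<subseteq> {1..}" "full D" "(d \<longlongrightarrow> 0) (inf sequentially (principal D))"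
proof -
  let ?e = "\<lambda>j. 1 / real (Suc j)"
  \<comment> \<open>The numbers \<open>f j\<close> are the window ends. Up to \<open>f j\<close> the
    threshold \<open>?e j\<close> fails rarely, and \<open>f j\<close> is a small fraction of
    \<open>f (Suc j)\<close>; the disjunct \<open>j = 0\<close> leaves the starting point
    free.\<close>
  have "\<exists>f. \<forall>j. (j = 0 \<or> real (card ({1..f j} - {n. d n < ?e j})) < ?e j * real (f j)) \<and>
      (f j < f (Suc j) \<and> real (f j) < ?e (Suc j) * real (f (Suc j)))"
  proof (rule dependent_nat_choice)
    fix N j
    obtain K :: nat where K: "real N < ?e (Suc j) * real K"
      using reals_Archimedean3[of "?e (Suc j)"] by (auto simp: mult.commute)
    obtain N' where N': "N' \<ge> max K (Suc N)"
      "real (card ({1..N'} - {n. d n < ?e (Suc j)})) < ?e (Suc j) * real N'"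
      using fullD[OF full[of "?e (Suc j)"], of "?e (Suc j)" "max K (Suc N)"] by auto
    have "?e (Suc j) * real K \<le> ?e (Suc j) * real N'"
      using N'(1) by (intro mult_left_mono) auto
    then show "\<exists>y. (Suc j = 0 \<or> real (card ({1..y} - {n. d n < ?e (Suc j)})) < ?e (Suc j) * real y) \<and>
        N < y \<and> real N < ?e (Suc j) * real y"
      using N' K by (intro exI[of _ N']) auto
  qed simp
  then obtain f where f: "\<And>j. j = 0 \<or> real (card ({1..f j} - {n. d n < ?e j})) < ?e j * real (f j)"
    "\<And>j. f j < f (Suc j)" "\<And>j. real (f j) < ?e (Suc j) * real (f (Suc j))"
    by blast
  have sm: "strict_mono f" using f(2) by (simp add: strict_mono_Suc_iff)
  define D where "D = {n. \<exists>j. f j < n \<and> n \<le> f (Suc j) \<and> d n < ?e (Suc j)}"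
  have "full D"
    unfolding full_def
  proof (intro allI impI)
    fix c :: real and M :: nat assume c: "c > 0"
    obtain J where J: "?e J < c / 2" using nat_approx_posE[of "c / 2"] c by auto
    \<comment> \<open>Both sources of exceptions, the earlier windows and the failures in the
      current one, stay below the fraction \<open>c / 2\<close>; \<open>j \<ge> M\<close> makes the
      window end late enough.\<close>
    define j where "j = max J M"
    have ej: "?e (Suc j) \<le> ?e J" by (simp add: j_def frac_le)
    have "card ({1..f (Suc j)} - D) \<le> card ({1..f j} \<union> ({1..f (Suc j)} - {n. d n < ?e (Suc j)}))"
    proof (intro card_mono subsetI)
      fix n assume n: "n \<in> {1..f (Suc j)} - D"
      then have "\<not> (f j < n \<and> n \<le> f (Suc j) \<and> d n < ?e (Suc j))" unfolding D_def by blast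
      then show "n \<in> {1..f j} \<union> ({1..f (Suc j)} - {n. d n < ?e (Suc j)})" using n by auto
    qed simp
    also have "\<dots> \<le> f j + card ({1..f (Suc j)} - {n. d n < ?e (Suc j)})"
      using card_Un_le[of "{1..f j}"] by (metis card_atLeastAtMost diff_Suc_1)
    finally have "real (card ({1..f (Suc j)} - D)) < ?e (Suc j) * real (f (Suc j)) + ?e (Suc j) * real (f (Suc j))"
      using f(1)[of "Suc j"] f(3)[of j] by linarith
    also have "\<dots> = (2 * ?e (Suc j)) * real (f (Suc j))" by simp
    also have "\<dots> \<le> c * real (f (Suc j))"
      using ej J by (intro mult_right_mono) auto
    finally show "\<exists>N\<ge>M. real (card ({1..N} - D)) < c * real N"
      using strict_mono_imp_increasing[OF sm, of "Suc j"] by (intro exI[of _ "f (Suc j)"]) (auto simp: j_def)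
  qed
  moreover have "(d \<longlongrightarrow> 0) (inf sequentially (principal D))"
  proof (rule order_tendstoI)
    fix \<tau> :: real assume "\<tau> > 0"
    then obtain J where J: "?e J < \<tau>" using nat_approx_posE by blast
    have "d n < \<tau>" if n: "n \<ge> Suc (f J)" "n \<in> D" for n
    proof -
      obtain j where j: "f j < n" "n \<le> f (Suc j)" "d n < ?e (Suc j)"
        using n(2) unfolding D_def by blast
      then have "f J < f (Suc j)" using n(1) by linarith
      then have "J < Suc j" using sm by (simp add: strict_mono_less)
      then have "?e (Suc j) \<le> ?e J" by (simp add: frac_le)
      then show ?thesis using j(3) J by linarith
    qed
    then show "eventually (\<lambda>n. d n < \<tau>) (inf sequentially (principal D))"
      unfolding eventually_inf_principal eventually_sequentially by blast
  next
    fix \<tau> :: real assume "\<tau> < 0"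
    then show "eventually (\<lambda>n. \<tau> < d n) (inf sequentially (principal D))"
      using d by (intro always_eventually) (auto intro: less_le_trans)
  qed
  moreover have "D \<subseteq> {1..}" by (auto simp: D_def)
  ultimately show ?thesis using that by blast
qed

subsection \<open>Weighted shifts\<close>

text \<open>Coordinates are split off one at a time. The bound reduces convergence of finitely
  supported orbits to single coordinates.\<close>

lemma fnorm_le_sum:
  assumes p: "p = 0 \<or> p \<ge> 1" and F: "finite F" and v: "\<And>j. 0 \<le> v j"
  shows "fnorm p F v \<le> (\<Sum>j\<in>F. v j)"
  using F
proof (induction F rule: finite_induct)
  case (insert x F)
  have "fnorm p (insert x F) v \<le> fnorm p (insert x F \<inter> {x}) v + fnorm p (insert x F - {x}) v"
    using insert.hyps v by (intro fnorm_split[OF p]) auto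
  also have "insert x F - {x} = F" using insert.hyps by auto
  also have "insert x F \<inter> {x} = {x}" by auto
  also have "fnorm p {x} v = v x" using p v[of x] by (auto simp: fnorm_def powr_powr)
  finally show ?case using insert by simp
qed simp

lemma half_power_le:
  fixes \<epsilon> :: real
  assumes "\<epsilon> > 0"
  obtains q :: nat where "q \<ge> 1" "(1 / 2) ^ q \<le> \<epsilon>"
proof -
  obtain n where "(1 / 2 :: real) ^ n < \<epsilon>"
    using real_arch_pow_inv[OF assms, of "1 / 2"] by auto
  then have "(1 / 2 :: real) ^ Suc n \<le> \<epsilon>" using assms by simp
  then show ?thesis using that[of "Suc n"] by simp
qed

locale koethe_shift = koethe p a for p a +
  fixes w :: "int \<Rightarrow> 'a::{real_normed_field,banach}"
  assumes invariant: "backward_shift w ` koethe_space p a \<subseteq> koethe_space p a"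
    and continuous:
      "continuous_map (koethe_topology p a) (koethe_topology p a) (backward_shift w)"
begin

abbreviation T :: "nat \<Rightarrow> (int \<Rightarrow> 'a) \<Rightarrow> int \<Rightarrow> 'a" where
  "T n \<equiv> backward_shift w ^^ n"

text \<open>Coordinate \<open>i = j + n\<close> moves to \<open>i - n\<close> and picks up
  \<open>weight_prod w i n\<close>; different coordinates never mix.\<close>

lemma T_apply: "T n x j = weight_prod w (j + int n) n * x (j + int n)"
proof (induction n arbitrary: j)
  case 0
  then show ?case by (simp add: weight_prod_def)
next
  case (Suc n)
  have "{j..j + int n} = insert j {j + 1..j + int n}" by auto
  then have "weight_prod w (j + int (Suc n)) (Suc n) = w j * weight_prod w (j + 1 + int n) n"
    by (simp add: weight_prod_def)
  then show ?case
    using Suc[of "j + 1"] by (simp add: backward_shift_def mult.assoc add.commute add.left_commute)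
qed

lemma T_in_space: "x \<in> X \<Longrightarrow> T n x \<in> X"
  using invariant by (induction n) auto

lemma T_add: "T (n + s) x = T n (T s x)"
  by (simp add: funpow_add)

lemma T_diff: "T n (\<lambda>j. x j - y j) = (\<lambda>j. T n x j - T n y j)"
  by (simp add: fun_eq_iff T_apply right_diff_distrib)

lemma T_scale: "T n (\<lambda>j. c * x j) = (\<lambda>j. c * T n x j)"
  by (simp add: fun_eq_iff T_apply)

lemma dist_T:
  "x \<in> X \<Longrightarrow> y \<in> X \<Longrightarrow> koethe_dist p a (T n x) (T n y) = gauge (T n (\<lambda>j. x j - y j))"
  by (simp add: dist_eq_gauge T_in_space T_diff)

section \<open>Continuity of the iterates in terms of seminorms\<close>

text \<open>Continuity at zero, with balls of the metric replaced by seminorm conditions through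
  \<open>gauge_ge\<close> in the target and \<open>gauge_le\<close> in the source.\<close>

lemma shift_bounded:
  assumes k: "k \<ge> 1" and e: "\<epsilon> > 0"
  shows "\<exists>q\<ge>1. \<exists>\<delta>>0. \<forall>x\<in>X. nrm q x < \<delta> \<longrightarrow> nrm k (backward_shift w x) < \<epsilon>"
proof -
  interpret Metric_space "X :: (int \<Rightarrow> 'a) set" "koethe_dist p a"
    by (rule Metric_space_koethe)
  let ?z = "(\<lambda>j. 0) :: int \<Rightarrow> 'a"
  let ?T = "backward_shift w"
  have Tz: "?T ?z = ?z" by (simp add: backward_shift_def)
  have zX: "?z \<in> X" by (rule space_zero)
  \<comment> \<open>By \<open>gauge_ge\<close>, a gauge below this radius forces
    \<open>min 1 (nrm k _) < min 1 \<epsilon>\<close>, hence a seminorm below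
    \<open>\<epsilon>\<close>.\<close>
  define r where "r = (1 / 2) ^ k * min 1 \<epsilon>"
  have r: "r > 0" using e by (simp add: r_def)
  have "openin mtopology {x \<in> topspace mtopology. ?T x \<in> mball ?z r}"
    using continuous openin_mball by (rule openin_continuous_map_preimage)
  moreover have "?z \<in> {x \<in> topspace mtopology. ?T x \<in> mball ?z r}"
    using zX Tz r mdist_zero[OF zX] by simp
  ultimately obtain s where s: "s > 0" "mball ?z s \<subseteq> {x \<in> topspace mtopology. ?T x \<in> mball ?z r}"
    unfolding openin_mtopology by meson
  obtain q :: nat where q: "q \<ge> 1" "(1 / 2) ^ q \<le> s / 2" using half_power_le[of "s / 2"] s(1) by auto
  have gz: "koethe_dist p a ?z x = gauge x" if "x \<in> X" for x :: "int \<Rightarrow> 'a"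
  proof -
    have "gauge (\<lambda>j. 0 - x j) = gauge x" by (rule gauge_cong_norm) simp
    then show ?thesis using that zX by (simp add: dist_eq_gauge)
  qed
  have "nrm k (?T x) < \<epsilon>" if x: "x \<in> X" "nrm q x < s / 2" for x
  proof -
    have "gauge x < s" using gauge_le[OF x(1) q(1)] q(2) x(2) by linarith
    then have "x \<in> mball ?z s" using x gz zX by simp
    then have "?T x \<in> mball ?z r" using s(2) by blast
    then have Tx: "?T x \<in> X" and "gauge (?T x) < r" using gz by auto
    then have "(1 / 2) ^ k * min 1 (nrm k (?T x)) < (1 / 2) ^ k * min 1 \<epsilon>"
      using gauge_ge[OF Tx k] unfolding r_def by linarith
    then have "min 1 (nrm k (?T x)) < min 1 \<epsilon>" by (rule mult_left_less_imp_less) simp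
    then show ?thesis by linarith
  qed
  then show ?thesis using q(1) s(1) by (intro exI[of _ q] conjI exI[of _ "s / 2"]) auto
qed

lemma T_bounded:
  assumes "k \<ge> 1" "\<epsilon> > 0"
  shows "\<exists>q\<ge>1. \<exists>\<delta>>0. \<forall>x\<in>X. nrm q x < \<delta> \<longrightarrow> nrm k (T n x) < \<epsilon>"
  using assms
proof (induction n arbitrary: k \<epsilon>)
  case 0
  then show ?case by auto
next
  case (Suc n)
  obtain q \<delta> where q: "q \<ge> 1" "\<delta> > 0" "\<And>x. x \<in> X \<Longrightarrow> nrm q x < \<delta> \<Longrightarrow> nrm k (backward_shift w x) < \<epsilon>"
    using shift_bounded[OF Suc.prems] by blast
  obtain q' \<delta>' where q': "q' \<ge> 1" "\<delta>' > 0" "\<And>x. x \<in> X \<Longrightarrow> nrm q' x < \<delta>' \<Longrightarrow> nrm q (T n x) < \<delta>"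
    using Suc.IH[OF q(1,2)] by blast
  have "nrm k (T (Suc n) x) < \<epsilon>" if "x \<in> X" "nrm q' x < \<delta>'" for x
    using q(3)[OF T_in_space[OF that(1)] q'(3)[OF that]] by simp
  then show ?case using q'(1,2) by blast
qed

text \<open>Finitely many iterates allow a common \<open>q\<close> and \<open>\<delta>\<close>. This
  later keeps a new summand small up to a time fixed before it is chosen.\<close>

lemma T_bounded_upto:
  assumes k: "k \<ge> 1" and e: "\<epsilon> > 0"
  shows "\<exists>q\<ge>1. \<exists>\<delta>>0. \<forall>x\<in>X. nrm q x < \<delta> \<longrightarrow> (\<forall>n\<le>M. nrm k (T n x) < \<epsilon>)"
proof (induction M)
  case 0
  then show ?case using T_bounded[OF assms, of 0] by simp
next
  case (Suc M)
  then obtain q \<delta> where q: "q \<ge> 1" "\<delta> > 0"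
    "\<And>x n. x \<in> X \<Longrightarrow> nrm q x < \<delta> \<Longrightarrow> n \<le> M \<Longrightarrow> nrm k (T n x) < \<epsilon>" by blast
  obtain q' \<delta>' where q': "q' \<ge> 1" "\<delta>' > 0"
    "\<And>x. x \<in> X \<Longrightarrow> nrm q' x < \<delta>' \<Longrightarrow> nrm k (T (Suc M) x) < \<epsilon>"
    using T_bounded[OF assms, of "Suc M"] by blast
  have "nrm k (T n x) < \<epsilon>" if x: "x \<in> X" "nrm (max q q') x < min \<delta> \<delta>'" "n \<le> Suc M" for x n
  proof -
    have "nrm q x < \<delta>" "nrm q' x < \<delta>'"
      using nrm_mono_index[OF x(1) q(1), of "max q q'"] nrm_mono_index[OF x(1) q'(1), of "max q q'"] x(2)
      by auto
    then show ?thesis using q(3)[OF x(1)] q'(3)[OF x(1)] x(3) by (metis le_Suc_eq)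
  qed
  then show ?case using q(1,2) q'(1,2)
    by (intro exI[of _ "max q q'"] conjI exI[of _ "min \<delta> \<delta>'"]) auto
qed

text \<open>The support is merely translated; reindexing it back to \<open>F\<close> produces the
  numerators of the growth condition.\<close>

lemma nrm_T_finite_support:
  assumes F: "finite F" "\<And>i. i \<notin> F \<Longrightarrow> x i = 0" and k: "k \<ge> 1"
  shows "nrm k (T n x) = fnorm p F (\<lambda>i. a (i - int n) k * (norm (weight_prod w i n) * norm (x i)))"
proof -
  have "nrm k (T n x) = fnorm p ((\<lambda>i. i - int n) ` F) (wt k (T n x))"
  proof (rule nrm_finite_support)
    fix j assume "j \<notin> (\<lambda>i. i - int n) ` F"
    then have "j + int n \<notin> F" by force
    then show "T n x j = 0" using F(2) by (simp add: T_apply)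
  qed (use F k in auto)
  also have "\<dots> = fnorm p F (\<lambda>i. wt k (T n x) (i - int n))"
    by (rule fnorm_reindex) (simp add: inj_on_def)
  finally show ?thesis by (simp add: T_apply norm_mult)
qed

lemma nrm_T_tendsto_0:
  assumes F: "finite F" "\<And>i. i \<notin> F \<Longrightarrow> x i = 0" and k: "k \<ge> 1"
    and lim: "\<And>i. i \<in> F \<Longrightarrow> ((\<lambda>n. a (i - int n) k *\<^sub>R weight_prod w i n) \<longlongrightarrow> 0) \<F>"
  shows "((\<lambda>n. nrm k (T n x)) \<longlongrightarrow> 0) \<F>"
proof (rule tendsto_sandwich[OF _ _ tendsto_const])
  let ?h = "\<lambda>n. \<Sum>i\<in>F. norm (a (i - int n) k *\<^sub>R weight_prod w i n) * norm (x i)"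
  have "x \<in> X" using F by (rule space_finite_support)
  then show "eventually (\<lambda>n. 0 \<le> nrm k (T n x)) \<F>"
    using k by (intro always_eventually allI nrm_nonneg T_in_space)
  have "nrm k (T n x) \<le> ?h n" for n
  proof -
    have "nrm k (T n x) = fnorm p F (\<lambda>i. a (i - int n) k * (norm (weight_prod w i n) * norm (x i)))"
      by (rule nrm_T_finite_support[OF F k])
    also have "\<dots> \<le> (\<Sum>i\<in>F. a (i - int n) k * (norm (weight_prod w i n) * norm (x i)))"
      using k by (intro fnorm_le_sum[OF p F(1)]) simp
    also have "\<dots> = ?h n" using k by (simp add: mult.assoc)
    finally show ?thesis .
  qed
  then show "eventually (\<lambda>n. nrm k (T n x) \<le> ?h n) \<F>" by (intro always_eventually allI)
  have "(?h \<longlongrightarrow> (\<Sum>i\<in>F. 0 * norm (x i))) \<F>"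
    using lim by (intro tendsto_sum tendsto_mult tendsto_const tendsto_norm_zero)
  then show "(?h \<longlongrightarrow> 0) \<F>" by simp
qed

definition orbit_condition :: "nat set \<Rightarrow> int set \<Rightarrow> bool" where
  "orbit_condition D I \<longleftrightarrow>
     (\<forall>k\<ge>1. \<forall>i\<in>I.
        ((\<lambda>n. a (i - int n) k *\<^sub>R weight_prod w i n) \<longlongrightarrow> 0) (inf sequentially (principal D)))"

text \<open>The second condition of the theorem in a form common to both kinds of spaces. For
  \<open>p \<ge> 1\<close> a \<open>p\<close>-th root has been taken, so quotients are compared with
  \<open>k\<close> itself.\<close>

definition growth_condition :: "int set \<Rightarrow> nat \<Rightarrow> (nat \<Rightarrow> nat) \<Rightarrow> bool" where
  "growth_condition I m N \<longleftrightarrow>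
     (\<forall>k\<ge>1. \<exists>r\<ge>1. \<exists>(i :: nat \<Rightarrow> int) (b :: nat \<Rightarrow> 'a).
        (\<forall>j\<in>{1..r}. i j \<in> I \<and> b j \<noteq> 0) \<and>
        fnorm p {1..r} (\<lambda>j. norm (a (i j) (index_fun m k) *\<^sub>R b j)) > 0 \<and>
        real (card {n \<in> {1..N k}.
          fnorm p {1..r} (\<lambda>j. norm (a (i j - int n) m *\<^sub>R (b j * weight_prod w (i j) n))) /
          fnorm p {1..r} (\<lambda>j. norm (a (i j) (index_fun m k) *\<^sub>R b j)) > real k})
        > (1 - 1 / real k) * real (N k))"

lemma index_fun_ge: "m \<ge> 1 \<Longrightarrow> m \<le> index_fun m k" "m \<ge> 1 \<Longrightarrow> 1 \<le> index_fun m k" "k \<le> index_fun m k"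
  by (auto simp: index_fun_def)

text \<open>
  Passing to nonnegative coordinates is harmless, as the seminorms
  only see absolute values, and it rules out cancellation when these vectors are added up.
\<close>

lemma growth_conditionE:
  assumes G: "growth_condition I m N" and m: "m \<ge> 1" and k: "k \<ge> 1"
  obtains h :: "int \<Rightarrow> real" and F
  where "finite F" "F \<subseteq> I" "\<And>i. i \<notin> F \<Longrightarrow> h i = 0" "\<And>i. 0 \<le> h i"
    "nrm (index_fun m k) (\<lambda>i. of_real (h i) :: 'a) = 1 / sqrt (real k)"
    "real (card ({1..N k} - {n. nrm m (T n (\<lambda>i. of_real (h i))) > sqrt (real k)})) < 1 / real k * real (N k)"
proof -
  let ?q = "index_fun m k"
  obtain r and i :: "nat \<Rightarrow> int" and b :: "nat \<Rightarrow> 'a" where r: "r \<ge> 1" "\<And>j. j \<in> {1..r} \<Longrightarrow> i j \<in> I"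
    and den: "fnorm p {1..r} (\<lambda>j. norm (a (i j) ?q *\<^sub>R b j)) > 0"
    and num: "real (card {n \<in> {1..N k}.
          fnorm p {1..r} (\<lambda>j. norm (a (i j - int n) m *\<^sub>R (b j * weight_prod w (i j) n))) /
          fnorm p {1..r} (\<lambda>j. norm (a (i j) ?q *\<^sub>R b j)) > real k})
        > (1 - 1 / real k) * real (N k)"
    using G[unfolded growth_condition_def, rule_format, OF k] by blast
  let ?num = "\<lambda>n. fnorm p {1..r} (\<lambda>j. norm (a (i j - int n) m *\<^sub>R (b j * weight_prod w (i j) n)))"
  let ?den = "fnorm p {1..r} (\<lambda>j. norm (a (i j) ?q *\<^sub>R b j))"
  \<comment> \<open>Coordinate \<open>l\<close> collects all \<open>b j\<close> with
    \<open>i j = l\<close>. By \<open>fnorm_fibres\<close> this changes neither the denominator nor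
    any numerator.\<close>
  define g where "g = (\<lambda>l. fnorm p {j \<in> {1..r}. i j = l} (\<lambda>j. norm (b j)))"
  let ?F = "i ` {1..r}"
  have F: "finite ?F" by simp
  have g0: "g l = 0" if "l \<notin> ?F" for l
  proof -
    have empty: "{j \<in> {1..r}. i j = l} = {}" using that by auto
    show ?thesis unfolding g_def empty by (rule fnorm_empty)
  qed
  have g_nonneg: "0 \<le> g l" for l by (simp add: g_def fnorm_nonneg)
  have q: "?q \<ge> 1" using index_fun_ge(2)[OF m] .
  \<comment> \<open>This scaling gives the vector norm \<open>1 / sqrt k\<close>, so that a quotient
    above \<open>k\<close> means an orbit norm above \<open>sqrt k\<close>.\<close>
  define s where "s = 1 / (?den * sqrt (real k))"
  have s: "s > 0" using den k by (simp add: s_def)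
  define h where "h = (\<lambda>l. s * g l)"
  let ?g = "\<lambda>l. of_real (g l) :: 'a"
  have g_space: "?g \<in> X" using F g0 by (intro space_finite_support[OF F]) auto
  have h_eq: "(\<lambda>l. of_real (h l)) = (\<lambda>l. of_real s * ?g l)" by (simp add: h_def)
  have den_eq: "nrm ?q ?g = ?den"
  proof -
    have "nrm ?q ?g = fnorm p ?F (\<lambda>l. a l ?q * g l)"
      using nrm_finite_support[OF F _ q, of ?g] g0 g_nonneg by simp
    also have "\<dots> = fnorm p {1..r} (\<lambda>j. a (i j) ?q * norm (b j))"
      unfolding g_def using q by (intro fnorm_fibres[OF p, symmetric]) auto
    finally show ?thesis using q by simp
  qed
  have num_eq: "nrm m (T n ?g) = ?num n" for n
  proof -
    have "nrm m (T n ?g) = fnorm p ?F (\<lambda>l. a (l - int n) m * norm (weight_prod w l n) * g l)"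
      using nrm_T_finite_support[OF F _ m, of ?g n] g0 g_nonneg by (simp add: mult.assoc)
    also have "\<dots> = fnorm p {1..r} (\<lambda>j. a (i j - int n) m * norm (weight_prod w (i j) n) * norm (b j))"
      unfolding g_def using m by (intro fnorm_fibres[OF p, symmetric]) auto
    finally show ?thesis using m by (simp add: norm_mult mult.assoc mult.commute mult.left_commute)
  qed
  have "nrm ?q (\<lambda>l. of_real (h l) :: 'a) = s * ?den"
    unfolding h_eq nrm_scale[OF g_space q] den_eq using s by simp
  then have 1: "nrm ?q (\<lambda>l. of_real (h l) :: 'a) = 1 / sqrt (real k)"
    using den by (simp add: s_def)
  have "nrm m (T n (\<lambda>l. of_real (h l))) > sqrt (real k) \<longleftrightarrow> ?num n / ?den > real k" for n
  proof -
    have "nrm m (T n (\<lambda>l. of_real (h l))) = s * ?num n"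
      unfolding h_eq T_scale nrm_scale[OF T_in_space[OF g_space] m] num_eq using s by simp
    also have "\<dots> = (?num n / ?den) / sqrt (real k)" by (simp add: s_def)
    finally have "nrm m (T n (\<lambda>l. of_real (h l))) > sqrt (real k) \<longleftrightarrow>
        sqrt (real k) * sqrt (real k) < ?num n / ?den"
      using k by (simp only: pos_less_divide_eq real_sqrt_gt_zero of_nat_0_less_iff less_le_trans[OF zero_less_one])
    then show ?thesis by simp
  qed
  then have 2: "real (card ({1..N k} - {n. nrm m (T n (\<lambda>l. of_real (h l))) > sqrt (real k)})) < 1 / real k * real (N k)"
    using num unfolding card_frequency_iff[symmetric] by simp
  show ?thesis
    by (rule that[OF F _ _ _ 1 2]) (use r g0 g_nonneg s in \<open>auto simp: h_def\<close>)
qed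

end

subsection \<open>Sufficiency\<close>

lemma inverse_sqrt_less: "1 / sqrt (real k) < \<delta>" if "\<delta> > 0" "real k > (1 / \<delta>)\<^sup>2"
proof -
  have "1 / \<delta> < sqrt (real k)" using that by (simp add: real_less_rsqrt)
  moreover have "0 < 1 / \<delta>" using that by simp
  ultimately have "0 < sqrt (real k)" by (rule less_trans[rotated])
  moreover have "1 < sqrt (real k) * \<delta>"
    using \<open>1 / \<delta> < sqrt (real k)\<close> that(1) by (simp only: pos_divide_less_eq)
  ultimately show ?thesis by (simp only: pos_divide_less_eq mult.commute)
qed

context koethe_shift
begin

text \<open>The difference of two real multiples of \<open>x\<close> is again a real multiple of
  \<open>x\<close>, and a nonzero factor preserves both hypotheses on the orbit.\<close>

lemma distributionally_chaotic_if_irregular: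
  assumes x: "x \<in> X" and m: "m \<ge> 1"
    and unb: "\<And>K. full {n. K \<le> nrm m (T n x)}"
    and null: "\<And>q \<tau>. q \<ge> 1 \<Longrightarrow> \<tau> > 0 \<Longrightarrow> full {n. nrm q (T n x) < \<tau>}"
  shows "distributionally_chaotic X (koethe_dist p a) (backward_shift w)"
proof -
  define v where "v = (\<lambda>(\<mu>::real) j. of_real \<mu> * x j)"
  have v: "v \<mu> \<in> X" for \<mu> unfolding v_def by (rule space_scale[OF x])
  have diff: "(\<lambda>j. v \<mu> j - v \<nu> j) = v (\<mu> - \<nu>)" for \<mu> \<nu>
    by (simp add: v_def fun_eq_iff algebra_simps)
  have nrm_T: "nrm k (T n (v \<mu>)) = \<bar>\<mu>\<bar> * nrm k (T n x)" if "k \<ge> 1" for k n \<mu>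
    unfolding v_def T_scale by (simp add: nrm_scale[OF T_in_space[OF x] that])
  \<comment> \<open>The zero vector has no unbounded orbit. A nonzero coordinate makes
    \<open>v\<close> injective, so its range is uncountable.\<close>
  obtain j where j: "x j \<noteq> 0"
  proof (rule ccontr)
    assume "\<not> thesis"
    then have "x = (\<lambda>j. 0)" using that by blast
    then have zero: "nrm m (T n x) = 0" for n
      using nrm_T_finite_support[of "{}" x m n] m by simp
    have "{n. 1 \<le> nrm m (T n x)} = {}" unfolding zero by simp
    then show False using full_infinite[OF unb[of 1]] by simp
  qed
  have "inj v" by (rule injI, drule fun_cong[where x = j]) (simp add: v_def j)
  have d: "koethe_dist p a (T n (v \<mu>)) (T n (v \<nu>)) = gauge (T n (v (\<mu> - \<nu>)))" for n \<mu> \<nu>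
    unfolding dist_T[OF v v] diff ..
  have unc: "uncountable (range v)"
    using \<open>inj v\<close> uncountable_UNIV_real countable_image_inj_on by blast
  have sub: "range v \<subseteq> X" using v by blast
  \<comment> \<open>By \<open>gauge_ge\<close>, the distance is at least \<open>(1 / 2) ^ m\<close>
    as soon as seminorm \<open>m\<close> of the difference reaches 1; one constant therefore serves
    all pairs.\<close>
  have "liminf (\<lambda>k. ereal (real (card {n \<in> {1..k}. koethe_dist p a (T n y) (T n z) < (1 / 2) ^ m}) / real k)) = 0 \<and>
      (\<forall>\<tau>>0. limsup (\<lambda>k. ereal (real (card {n \<in> {1..k}. koethe_dist p a (T n y) (T n z) < \<tau>}) / real k)) = 1)"
    if mem: "y \<in> range v" "z \<in> range v" "y \<noteq> z" for y z
  proof -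
    obtain \<mu> \<nu> where yz: "y = v \<mu>" "z = v \<nu>" and "\<mu> \<noteq> \<nu>" using mem by blast
    then have c: "\<bar>\<mu> - \<nu>\<bar> > 0" by simp
    have set_eq: "{n \<in> {1..k}. P n} = {1..k} \<inter> {n. P n}" for k :: nat and P by auto
    have "full (- {n. koethe_dist p a (T n y) (T n z) < (1 / 2) ^ m})"
    proof (rule full_mono[OF unb[of "1 / \<bar>\<mu> - \<nu>\<bar>"]])
      fix n assume "n \<in> {n. 1 / \<bar>\<mu> - \<nu>\<bar> \<le> nrm m (T n x)}"
      then have "1 \<le> nrm m (T n (v (\<mu> - \<nu>)))"
        using c unfolding nrm_T[OF m] by (simp add: field_simps)
      then have "(1 / 2) ^ m \<le> gauge (T n (v (\<mu> - \<nu>)))"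
        using gauge_ge[OF T_in_space[OF v] m, of n "\<mu> - \<nu>"] by simp
      then show "n \<in> - {n. koethe_dist p a (T n y) (T n z) < (1 / 2) ^ m}"
        unfolding yz d by simp
    qed
    moreover have "full {n. koethe_dist p a (T n y) (T n z) < \<tau>}" if "\<tau> > 0" for \<tau>
    proof -
      obtain q :: nat where q: "q \<ge> 1" "(1 / 2) ^ q \<le> \<tau> / 2" using half_power_le[of "\<tau> / 2"] \<open>\<tau> > 0\<close> by auto
      show ?thesis
      proof (rule full_mono[OF null[OF q(1), of "\<tau> / 2 / \<bar>\<mu> - \<nu>\<bar>"]])
        show "0 < \<tau> / 2 / \<bar>\<mu> - \<nu>\<bar>" using c \<open>\<tau> > 0\<close> by simp
        fix n assume "n \<in> {n. nrm q (T n x) < \<tau> / 2 / \<bar>\<mu> - \<nu>\<bar>}"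
        then have "nrm q (T n (v (\<mu> - \<nu>))) < \<tau> / 2"
          using c unfolding nrm_T[OF q(1)] by (simp add: field_simps)
        then have "gauge (T n (v (\<mu> - \<nu>))) < \<tau>"
          using gauge_le[OF T_in_space[OF v] q(1), of n "\<mu> - \<nu>"] q(2) by linarith
        then show "n \<in> {n. koethe_dist p a (T n y) (T n z) < \<tau>}"
          unfolding yz d by simp
      qed
    qed
    ultimately show ?thesis
      unfolding set_eq liminf_frequency_eq_0_iff limsup_frequency_eq_1_iff by blast
  qed
  then show ?thesis
    unfolding distributionally_chaotic_def using unc sub
    by (intro exI[of _ "range v"] exI[of _ "(1 / 2) ^ m"] conjI ballI impI) simp_all
qed

text \<open>
  A sparse subsequence of the normalised vectors is summed up. Every summand keeps the orbit of the sum
  large on a long interval, since there is no cancellation; the choice of \<open>\<kappa> (Suc j)\<close> after \<open>M j\<close> leaves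
  the orbit small at most times up to \<open>M j\<close>.
\<close>

lemma irregular_vector_exists:
  assumes D: "full D" and orb: "orbit_condition D I" and m: "m \<ge> 1"
    and N: "strict_mono_on {1..} N" and growth: "growth_condition I m N"
  obtains x where "x \<in> X" "\<And>K. full {n. K \<le> nrm m (T n x)}"
    "\<And>q \<tau>. q \<ge> 1 \<Longrightarrow> \<tau> > 0 \<Longrightarrow> full {n. nrm q (T n x) < \<tau>}"
proof -
  define R where "R = (\<lambda>k h F. finite F \<and> F \<subseteq> I \<and> (\<forall>i. i \<notin> F \<longrightarrow> h i = 0) \<and> (\<forall>i. 0 \<le> h i) \<and>
    nrm (index_fun m k) (\<lambda>i. of_real (h i) :: 'a) = 1 / sqrt (real k) \<and>
    real (card ({1..N k} - {n. nrm m (T n (\<lambda>i. of_real (h i))) > sqrt (real k)})) < 1 / real k * real (N k))"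
  have "\<exists>h F. R k h F" if k: "k \<ge> 1" for k
  proof (rule growth_conditionE[OF growth m k])
    fix h F
    assume "finite F" "F \<subseteq> I" "\<And>i. i \<notin> F \<Longrightarrow> h i = 0" "\<And>i. 0 \<le> h i"
      "nrm (index_fun m k) (\<lambda>i. of_real (h i) :: 'a) = 1 / sqrt (real k)"
      "real (card ({1..N k} - {n. nrm m (T n (\<lambda>i. of_real (h i))) > sqrt (real k)})) < 1 / real k * real (N k)"
    then have "R k h F" unfolding R_def by blast
    then show ?thesis by blast
  qed
  then obtain h F where "\<And>k. k \<ge> 1 \<Longrightarrow> R k (h k) (F k)" by metis
  then have h: "finite (F k)" "F k \<subseteq> I" "i \<notin> F k \<Longrightarrow> h k i = 0" "0 \<le> h k i"
    "nrm (index_fun m k) (\<lambda>i. of_real (h k i) :: 'a) = 1 / sqrt (real k)"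
    "real (card ({1..N k} - {n. nrm m (T n (\<lambda>i. of_real (h k i))) > sqrt (real k)})) < 1 / real k * real (N k)"
    if "k \<ge> 1" for k i
    using that unfolding R_def by blast+
  define z where "z = (\<lambda>k i. of_real (h k i) :: 'a)"
  have z: "z k \<in> X" if "k \<ge> 1" for k
    unfolding z_def using h(1,3)[OF that] by (intro space_finite_support[of "F k"]) auto
  have z_lim: "((\<lambda>n. nrm q (T n (z k))) \<longlongrightarrow> 0) (inf sequentially (principal D))" if "k \<ge> 1" "q \<ge> 1" for k q
  proof (rule nrm_T_tendsto_0[OF h(1)[OF that(1)] _ that(2)])
    show "z k i = 0" if "i \<notin> F k" for i using h(3)[OF \<open>k \<ge> 1\<close> that] by (simp add: z_def)
    show "((\<lambda>n. a (i - int n) q *\<^sub>R weight_prod w i n) \<longlongrightarrow> 0) (inf sequentially (principal D))" if "i \<in> F k" for i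
      using orb h(2)[OF \<open>k \<ge> 1\<close>] that \<open>q \<ge> 1\<close> unfolding orbit_condition_def by blast
  qed
  \<comment> \<open>Since \<open>index_fun m k \<ge> k\<close>, any given seminorm of
    \<open>z k\<close> is eventually bounded by the normalised one, which is
    \<open>1 / sqrt k\<close>.\<close>
  have z_small: "\<exists>k>L. \<forall>n\<le>M. nrm q (T n (z k)) < \<epsilon>" if q: "q \<ge> 1" and e: "\<epsilon> > 0" for q \<epsilon> M L
  proof -
    obtain q' \<delta> where q': "q' \<ge> 1" "\<delta> > 0" "\<And>x. x \<in> X \<Longrightarrow> nrm q' x < \<delta> \<Longrightarrow> \<forall>n\<le>M. nrm q (T n x) < \<epsilon>"
      using T_bounded_upto[OF q e] by blast
    obtain k0 :: nat where k0: "real k0 > (1 / \<delta>)\<^sup>2" using reals_Archimedean2 by blast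
    define k where "k = max (max (Suc L) q') k0"
    have k: "k \<ge> 1" "k > L" "q' \<le> index_fun m k"
      using index_fun_ge(3)[of k m] by (auto simp: k_def)
    have "nrm q' (z k) \<le> nrm (index_fun m k) (z k)"
      by (rule nrm_mono_index[OF z[OF k(1)] q'(1) k(3)])
    also have "\<dots> = 1 / sqrt (real k)" unfolding z_def by (rule h(5)[OF k(1)])
    also have "\<dots> < \<delta>" using k0 by (intro inverse_sqrt_less q'(2)) (auto simp: k_def)
    finally show ?thesis using q'(3)[OF z[OF k(1)]] k(2) by blast
  qed
  \<comment> \<open>The sum runs over all indices up to \<open>\<kappa>\<close>, not only the
    selected ones, so the recursion need not remember earlier selections.\<close>
  define good where "good = (\<lambda>j \<kappa>. {n. (\<Sum>k=1..\<kappa>. nrm (Suc j) (T n (z k))) < 1 / real (Suc j)})"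
  have good: "full (good j \<kappa>)" for j \<kappa>
  proof (rule full_eventually[OF D])
    have "((\<lambda>n. \<Sum>k=1..\<kappa>. nrm (Suc j) (T n (z k))) \<longlongrightarrow> (\<Sum>k=1..\<kappa>. 0)) (inf sequentially (principal D))"
      by (intro tendsto_sum z_lim) auto
    then have "eventually (\<lambda>n. (\<Sum>k=1..\<kappa>. nrm (Suc j) (T n (z k))) < 1 / real (Suc j)) (inf sequentially (principal D))"
      by (intro order_tendstoD(2)) auto
    then show "eventually (\<lambda>n. n \<in> D \<longrightarrow> n \<in> good j \<kappa>) sequentially"
      by (simp add: eventually_inf_principal good_def)
  qed
  \<comment> \<open>A state is a pair of a selected index \<open>\<kappa> j\<close> and a time
    \<open>M j\<close>: \<open>P\<close> says that most times up to \<open>M j\<close> are good for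
    \<open>\<kappa> j\<close>, \<open>Q\<close> that the next selected vector stays small up to
    \<open>M j\<close>.\<close>
  define P where "P = (\<lambda>j (s :: nat \<times> nat). fst s \<ge> 1 \<and> snd s \<ge> j \<and>
    real (card ({1..snd s} - good j (fst s))) < 1 / real (Suc j) * real (snd s))"
  define Q where "Q = (\<lambda>j (s :: nat \<times> nat) (s' :: nat \<times> nat). fst s' > fst s \<and> snd s' \<ge> snd s \<and>
    (\<forall>n\<le>snd s. nrm (Suc j) (T n (z (fst s'))) < (1 / 2) ^ Suc j))"
  have "\<exists>f. \<forall>j. P j (f j) \<and> Q j (f j) (f (Suc j))"
  proof (rule dependent_nat_choice)
    obtain M where "real (card ({1..M} - good 0 1)) < 1 / real (Suc 0) * real M"
      using fullD[OF good[of 0 1], of "1 / real (Suc 0)"] by auto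
    then show "\<exists>s. P 0 s" by (intro exI[of _ "(1, M)"]) (simp add: P_def)
  next
    fix s j assume "P j s"
    obtain \<kappa> where \<kappa>: "\<kappa> > fst s" "\<forall>n\<le>snd s. nrm (Suc j) (T n (z \<kappa>)) < (1 / 2) ^ Suc j"
      using z_small[of "Suc j" "(1 / 2) ^ Suc j" "fst s" "snd s"] by auto
    obtain M where M: "M \<ge> max (snd s) (Suc j)"
      "real (card ({1..M} - good (Suc j) \<kappa>)) < 1 / real (Suc (Suc j)) * real M"
      using fullD[OF good[of "Suc j" \<kappa>], of "1 / real (Suc (Suc j))" "max (snd s) (Suc j)"] by auto
    show "\<exists>s'. P (Suc j) s' \<and> Q j s s'"
      using \<kappa> M by (intro exI[of _ "(\<kappa>, M)"]) (auto simp: P_def Q_def)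
  qed
  then obtain f where f: "\<And>j. P j (f j)" "\<And>j. Q j (f j) (f (Suc j))" by blast
  define \<kappa> M where "\<kappa> = fst \<circ> f" and "M = snd \<circ> f"
  have \<kappa>1: "\<kappa> j \<ge> 1" and Mj: "M j \<ge> j"
    and good_card: "real (card ({1..M j} - good j (\<kappa> j))) < 1 / real (Suc j) * real (M j)" for j
    using f(1)[of j] by (simp_all add: P_def \<kappa>_def M_def)
  have \<kappa>_mono: "strict_mono \<kappa>" and M_mono: "mono M"
    using f(2) by (simp_all add: Q_def \<kappa>_def M_def strict_mono_Suc_iff mono_iff_le_Suc)
  have small: "nrm (Suc j) (T n (z (\<kappa> (Suc j)))) < (1 / 2) ^ Suc j" if "n \<le> M j" for n j
    using f(2)[of j] that by (auto simp: Q_def \<kappa>_def M_def)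
  let ?u = "\<lambda>j. z (\<kappa> j)"
  have u: "?u j \<in> X" for j by (rule z[OF \<kappa>1])
  have tail: "nrm q (T n (?u i)) \<le> (1 / 2) ^ i" if "1 \<le> q" "q \<le> Suc j" "n \<le> M j" "j < i" for q n i j
  proof -
    obtain i' where i: "i = Suc i'" using \<open>j < i\<close> by (cases i) auto
    have "M j \<le> M i'" using monoD[OF M_mono] that(4) i by simp
    then have "nrm i (T n (?u i)) < (1 / 2) ^ i" using small[of n i'] that(3) i by simp
    moreover have "nrm q (T n (?u i)) \<le> nrm i (T n (?u i))"
      using that by (intro nrm_mono_index T_in_space u) auto
    ultimately show ?thesis by linarith
  qed
  have summable_half: "summable (\<lambda>i. (1 / 2 :: real) ^ i)" by (rule summable_geometric) simp
  have summable_u: "summable (\<lambda>i. nrm q (T n (?u i)))" if "1 \<le> q" "q \<le> Suc j" "n \<le> M j" for q n j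
  proof (rule summable_comparison_test[OF _ summable_half])
    show "\<exists>L. \<forall>i\<ge>L. norm (nrm q (T n (?u i))) \<le> (1 / 2) ^ i"
      using tail[OF that] nrm_nonneg[OF T_in_space[OF u] that(1)] by (intro exI[of _ "Suc j"]) auto
  qed
  have hk: "0 \<le> h (\<kappa> j) i" for i j by (rule h(4)[OF \<kappa>1])
  have "summable (\<lambda>j. h (\<kappa> j) i)" for i
  proof -
    obtain k where k: "k \<ge> 1" "a i k > 0" using a_pos by blast
    have "summable (\<lambda>j. nrm k (?u j))" using summable_u[OF k(1), of k 0] by simp
    then have "summable (\<lambda>j. nrm k (?u j) / a i k)" by (rule summable_divide)
    moreover have "norm (h (\<kappa> j) i) \<le> nrm k (?u j) / a i k" for j
      using wt_le_nrm[OF u[of j] k(1), of i] k(2) hk by (simp add: z_def field_simps)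
    ultimately show ?thesis by (rule summable_comparison_test')
  qed
  then obtain g where g: "\<And>i. (\<lambda>j. h (\<kappa> j) i) sums g i" unfolding summable_def by metis
  have g_nonneg: "0 \<le> g i" for i using sums_le[OF _ sums_zero g] hk by blast
  have h_le_g: "h (\<kappa> j) i \<le> g i" for i j
    using sum_le_suminf[OF sums_summable[OF g], of "{j}" i] hk sums_unique[OF g, of i] by simp
  define x where "x = (\<lambda>i. of_real (g i) :: 'a)"
  have norm_x: "(\<lambda>j. norm (?u j i)) sums norm (x i)" for i
    using g[of i] hk g_nonneg[of i] by (simp add: x_def z_def)
  have x: "x \<in> X"
  proof (rule space_sums[OF u _ norm_x])
    show "summable (\<lambda>j. nrm k (?u j))" if "k \<ge> 1" for k using summable_u[OF that, of k 0] by simp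
  qed
  have norm_Tx: "(\<lambda>j. norm (T n (?u j) i)) sums norm (T n x i)" for n i
    unfolding T_apply norm_mult by (rule sums_mult[OF norm_x])
  have "full {n. K \<le> nrm m (T n x)}" for K
    unfolding full_def
  proof (intro allI impI)
    fix c :: real and L :: nat assume c: "c > 0"
    obtain J1 :: nat where J1: "1 / c < real J1" using reals_Archimedean2 by blast
    obtain J2 :: nat where J2: "K\<^sup>2 < real J2" using reals_Archimedean2 by blast
    \<comment> \<open>As \<open>\<kappa> j \<ge> j\<close>, this ensures
      \<open>K \<le> sqrt (\<kappa> j)\<close> and \<open>1 / \<kappa> j \<le> c\<close>. The window
      used is \<open>N (\<kappa> j)\<close>, independently of \<open>M j\<close>.\<close>
    define j where "j = max L (max J1 J2)"
    have kj: "\<kappa> j \<ge> j" using strict_mono_imp_increasing[OF \<kappa>_mono] .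
    let ?k = "\<kappa> j"
    have "K \<le> sqrt (real ?k)"
      using J2 kj by (intro real_le_rsqrt) (auto simp: j_def)
    moreover have "nrm m (T n (z ?k)) \<le> nrm m (T n x)" for n
    proof (rule nrm_solid[OF T_in_space[OF x] m])
      fix i
      have "norm (z ?k l) \<le> norm (x l)" for l
        using h_le_g[of j l] hk[of j l] by (simp add: z_def x_def)
      then show "norm (T n (z ?k) i) \<le> norm (T n x i)"
        unfolding T_apply norm_mult by (intro mult_left_mono) auto
    qed
    ultimately have "{n. nrm m (T n (z ?k)) > sqrt (real ?k)} \<subseteq> {n. K \<le> nrm m (T n x)}"
      by (auto elim!: order_trans[OF order_trans[OF _ less_imp_le]])
    then have "card ({1..N ?k} - {n. K \<le> nrm m (T n x)}) \<le> card ({1..N ?k} - {n. nrm m (T n (z ?k)) > sqrt (real ?k)})"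
      by (intro card_mono) auto
    then have "real (card ({1..N ?k} - {n. K \<le> nrm m (T n x)})) \<le>
        real (card ({1..N ?k} - {n. nrm m (T n (z ?k)) > sqrt (real ?k)}))" by (rule of_nat_mono)
    also have "\<dots> < 1 / real ?k * real (N ?k)"
      using h(6)[OF \<kappa>1] by (simp add: z_def)
    also have "\<dots> \<le> c * real (N ?k)"
    proof (rule mult_right_mono)
      have "1 / c \<le> real ?k" using J1 kj by (simp add: j_def)
      then show "1 / real ?k \<le> c" using c \<kappa>1[of j] by (simp add: field_simps)
    qed simp
    finally have "real (card ({1..N ?k} - {n. K \<le> nrm m (T n x)})) < c * real (N ?k)" .
    \<comment> \<open>Makes the windows arbitrarily late. The strict cardinality bound at
      \<open>k = 1\<close> already forces \<open>N 1 > 0\<close>.\<close>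
    moreover have "N k \<ge> k" if "k \<ge> 1" for k
      using that
    proof (induction k rule: dec_induct)
      case base
      show ?case using h(6)[of 1] by (cases "N 1") auto
    next
      case (step k)
      then have "N k < N (Suc k)" using N by (intro strict_mono_onD[OF N]) auto
      then show ?case using step by simp
    qed
    ultimately show "\<exists>N'\<ge>L. real (card ({1..N'} - {n. K \<le> nrm m (T n x)})) < c * real N'"
      using kj \<kappa>1[of j] by (intro exI[of _ "N ?k"]) (auto simp: j_def intro: order_trans)
  qed
  moreover have "full {n. nrm q (T n x) < \<tau>}" if q: "q \<ge> 1" and t: "\<tau> > 0" for q \<tau>
    unfolding full_def
  proof (intro allI impI)
    fix c :: real and L :: nat assume c: "c > 0"
    obtain J1 :: nat where J1: "1 / real (Suc J1) < c" using nat_approx_posE[OF c] by auto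
    obtain J2 :: nat where J2: "1 / real (Suc J2) < \<tau> / 2" using nat_approx_posE[of "\<tau> / 2"] t by auto
    define j where "j = max (max L q) (max J1 J2)"
    have j: "j \<ge> L" "q \<le> Suc j" "1 / real (Suc j) < c" "1 / real (Suc j) < \<tau> / 2"
    proof -
      have "1 / real (Suc j) \<le> 1 / real (Suc J1)" "1 / real (Suc j) \<le> 1 / real (Suc J2)"
        by (intro divide_left_mono; simp add: j_def)+
      then show "1 / real (Suc j) < c" "1 / real (Suc j) < \<tau> / 2" using J1 J2 by auto
    qed (auto simp: j_def)
    have "nrm q (T n x) < \<tau>" if n: "n \<le> M j" "n \<in> good j (\<kappa> j)" for n
    proof -
      let ?v = "\<lambda>i. nrm (Suc j) (T n (?u i))"
      have sm: "summable ?v" using n(1) by (intro summable_u) auto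
      have v0: "0 \<le> nrm (Suc j) (T n (z k))" if "k \<ge> 1" for k
        using that by (intro nrm_nonneg T_in_space z) auto
      have "nrm q (T n x) \<le> nrm (Suc j) (T n x)" using q j(2) by (intro nrm_mono_index T_in_space x) auto
      also have "\<dots> \<le> (\<Sum>i. ?v i)"
        by (rule nrm_sums_le[OF _ _ sm T_in_space[OF x] norm_Tx]) (auto intro: T_in_space u)
      \<comment> \<open>Summands selected after step \<open>j\<close> are small because
        \<open>n \<le> M j\<close>; those up to step \<open>j\<close> are small because
        \<open>n\<close> is good. Each group stays below \<open>\<tau> / 2\<close>.\<close>
      also have "\<dots> = (\<Sum>i. ?v (i + Suc j)) + (\<Sum>i<Suc j. ?v i)"
        by (rule suminf_split_initial_segment[OF sm])
      also have "(\<Sum>i. ?v (i + Suc j)) \<le> (\<Sum>i. (1 / 2) ^ Suc i * (1 / 2) ^ j)"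
      proof (rule suminf_le)
        show "?v (i + Suc j) \<le> (1 / 2) ^ Suc i * (1 / 2) ^ j" for i
          using tail[of "Suc j" j n "i + Suc j"] n(1) by (simp add: power_add mult.commute)
        show "summable (\<lambda>i. ?v (i + Suc j))" by (rule summable_ignore_initial_segment[OF sm])
        show "summable (\<lambda>i. (1 / 2 :: real) ^ Suc i * (1 / 2) ^ j)"
          by (intro summable_mult2 summable_half_powers)
      qed
      also have "\<dots> = (1 / 2) ^ j"
        using sums_unique[OF sums_mult2[OF power_half_series, of "(1 / 2) ^ j"]] by simp
      also have "(1 / 2) ^ j \<le> 1 / real (Suc j)"
      proof -
        have "Suc j \<le> 2 ^ j" using less_exp[of j] by (simp add: Suc_le_eq)
        then have "real (Suc j) \<le> 2 ^ j" by (metis of_nat_le_iff of_nat_numeral of_nat_power)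
        then show ?thesis by (simp add: power_one_over frac_le del: of_nat_Suc)
      qed
      also have "(\<Sum>i<Suc j. ?v i) = (\<Sum>k\<in>\<kappa> ` {..<Suc j}. nrm (Suc j) (T n (z k)))"
        using strict_mono_on_imp_inj_on[OF \<kappa>_mono] by (subst sum.reindex) (auto intro: inj_on_subset)
      also have "\<dots> \<le> (\<Sum>k=1..\<kappa> j. nrm (Suc j) (T n (z k)))"
        using v0 \<kappa>1 monoD[OF strict_mono_mono[OF \<kappa>_mono]] by (intro sum_mono2) (auto simp: less_Suc_eq_le)
      also have "\<dots> < 1 / real (Suc j)" using n(2) by (simp add: good_def)
      finally show ?thesis using j(4) by simp
    qed
    then have "card ({1..M j} - {n. nrm q (T n x) < \<tau>}) \<le> card ({1..M j} - good j (\<kappa> j))"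
      by (intro card_mono) auto
    then have "real (card ({1..M j} - {n. nrm q (T n x) < \<tau>})) < 1 / real (Suc j) * real (M j)"
      using good_card[of j] by linarith
    also have "\<dots> \<le> c * real (M j)" using j(3) by (intro mult_right_mono) auto
    finally show "\<exists>N'\<ge>L. real (card ({1..N'} - {n. nrm q (T n x) < \<tau>})) < c * real N'"
      using j(1) Mj[of j] by (intro exI[of _ "M j"]) auto
  qed
  ultimately show ?thesis using that x by blast
qed

end

subsection \<open>Necessity and the characterization\<close>

context koethe_shift
begin

lemma sufficiency:
  assumes "upper_density D = 1" "orbit_condition D I" "m \<ge> 1" "strict_mono_on {1..} N"
    "growth_condition I m N"
  shows "distributionally_chaotic X (koethe_dist p a) (backward_shift w)"
proof (rule irregular_vector_exists)
  show "full D" using assms(1) by (simp add: upper_density_eq_1_iff)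
qed (use assms distributionally_chaotic_if_irregular in auto)

lemma nrm_posE:
  assumes "x \<in> X" "k \<ge> 1" "0 < nrm k x"
  obtains i where "a i k > 0" "x i \<noteq> 0"
proof (rule ccontr)
  assume neg: "\<not> thesis"
  have "a i k = 0 \<or> x i = 0" for i
    using that[of i] neg a_nonneg[OF assms(2), of i] by fastforce
  then have zero: "wt k x i = 0" for i by simp
  obtain F where F: "finite F" "\<And>G. finite G \<Longrightarrow> F \<subseteq> G \<Longrightarrow> 0 < fnorm p G (wt k x)"
    using nrm_truncate[OF assms] by blast
  have "fnorm p F (wt k x) = fnorm p {} (wt k x)"
    using F(1) zero by (intro fnorm_neutral[OF p]) auto
  then show False using F(2)[OF F(1)] by simp
qed

text \<open>
  The vectors of the growth condition are truncations of orbit points \<open>T s u\<close> with \<open>s \<in> D\<close>, whose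
  seminorms are small. The additional coordinate \<open>i0\<close> only ensures that the denominator is positive.
\<close>

lemma truncated_orbit_growth:
  assumes y: "y \<in> X" and m: "m \<ge> 1" and q: "m \<le> q" and e: "\<epsilon> > 0" "nrm q y < \<epsilon>"
    and i0: "a i0 m > 0"
  obtains r and i :: "nat \<Rightarrow> int" and b :: "nat \<Rightarrow> 'a" where
    "r \<ge> 1" "\<And>j. j \<in> {1..r} \<Longrightarrow> i j = i0 \<or> y (i j) \<noteq> 0" "\<And>j. j \<in> {1..r} \<Longrightarrow> b j \<noteq> 0"
    "0 < fnorm p {1..r} (\<lambda>j. norm (a (i j) q *\<^sub>R b j))"
    "fnorm p {1..r} (\<lambda>j. norm (a (i j) q *\<^sub>R b j)) < 2 * \<epsilon>"
    "\<And>n. n \<le> M \<Longrightarrow> C < nrm m (T n y) \<Longrightarrow>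
      C < fnorm p {1..r} (\<lambda>j. norm (a (i j - int n) m *\<^sub>R (b j * weight_prod w (i j) n)))"
proof -
  have q1: "q \<ge> 1" using m q by simp
  have "\<exists>F. finite F \<and> (C < nrm m (T n y) \<longrightarrow> C < fnorm p F (wt m (T n y)))" for n
  proof (cases "C < nrm m (T n y)")
    case True
    then show ?thesis using nrm_truncate[OF T_in_space[OF y] m, of C n] by (metis order_refl)
  qed auto
  then obtain F where F: "\<And>n. finite (F n)" "\<And>n. C < nrm m (T n y) \<Longrightarrow> C < fnorm p (F n) (wt m (T n y))"
    by metis
  have ai0: "a i0 q > 0" using i0 a_mono[OF m q, of i0] by linarith
  \<comment> \<open>Chosen so that coordinate \<open>i0\<close>, if it has to be added, contributes
    exactly \<open>\<epsilon> / 2\<close> in seminorm \<open>q\<close>.\<close>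
  define \<eta> where "\<eta> = \<epsilon> / (2 * a i0 q)"
  have \<eta>: "\<eta> > 0" using e(1) ai0 by (simp add: \<eta>_def)
  \<comment> \<open>The truncation sets of all \<open>T n y\<close> with \<open>n \<le> M\<close>,
    translated back to coordinates of \<open>y\<close>; zeros are dropped because the scalars
    \<open>b\<close> must be nonzero. Only \<open>i0\<close> can be a zero of \<open>y\<close> in
    \<open>S\<close>.\<close>
  define S where "S = insert i0 {l \<in> (\<Union>n\<le>M. (\<lambda>l. l + int n) ` F n). y l \<noteq> 0}"
  have S: "finite S" "i0 \<in> S" using F(1) by (auto simp: S_def)
  define \<beta> where "\<beta> = (\<lambda>l. if y l = 0 then of_real \<eta> else y l)"
  have \<beta>0: "\<beta> l \<noteq> 0" for l using \<eta> by (simp add: \<beta>_def)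
  obtain i where i: "bij_betw i {1..card S} S" using ex_bij_betw_nat_finite_1[OF S(1)] by blast
  define b where "b = (\<lambda>j. \<beta> (i j))"
  have reindex: "fnorm p {1..card S} (\<lambda>j. v (i j)) = fnorm p S v" for v
    using fnorm_reindex[of i "{1..card S}" p v] i by (simp add: bij_betw_def)
  have den: "fnorm p {1..card S} (\<lambda>j. norm (a (i j) q *\<^sub>R b j)) = fnorm p S (\<lambda>l. a l q * norm (\<beta> l))"
    using reindex[of "\<lambda>l. a l q * norm (\<beta> l)"] q1 by (simp add: b_def)
  have num: "fnorm p {1..card S} (\<lambda>j. norm (a (i j - int n) m *\<^sub>R (b j * weight_prod w (i j) n))) =
      fnorm p S (\<lambda>l. a (l - int n) m * norm (\<beta> l * weight_prod w l n))" for n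
    using reindex[of "\<lambda>l. a (l - int n) m * norm (\<beta> l * weight_prod w l n)"] m by (simp add: b_def)
  show ?thesis
  proof (rule that[of "card S" i b])
    show "card S \<ge> 1" using S by (auto simp: Suc_le_eq card_gt_0_iff)
    show "i j = i0 \<or> y (i j) \<noteq> 0" if "j \<in> {1..card S}" for j
      using bij_betwE[OF i] that by (auto simp: S_def)
    show "b j \<noteq> 0" for j by (simp add: b_def \<beta>0)
    have "0 < a i0 q * norm (\<beta> i0)" using ai0 \<beta>0 by simp
    also have "\<dots> \<le> fnorm p S (\<lambda>l. a l q * norm (\<beta> l))"
      using fnorm_ge[OF p S, of "\<lambda>l. a l q * norm (\<beta> l)"] ai0 by simp
    finally show "0 < fnorm p {1..card S} (\<lambda>j. norm (a (i j) q *\<^sub>R b j))" unfolding den .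
    have "fnorm p S (\<lambda>l. a l q * norm (\<beta> l)) \<le>
        fnorm p S (\<lambda>l. wt q y l + a l q * (if l = i0 then \<eta> else 0))"
      using \<eta> q1 by (intro fnorm_mono[OF p S(1)]) (auto simp: \<beta>_def S_def)
    also have "\<dots> \<le> fnorm p S (wt q y) + fnorm p S (\<lambda>l. a l q * (if l = i0 then \<eta> else 0))"
      using \<eta> q1 by (intro fnorm_triangle[OF p S(1)]) auto
    also have "fnorm p S (wt q y) \<le> nrm q y" by (rule fnorm_le_nrm[OF y q1 S(1)])
    also have "fnorm p S (\<lambda>l. a l q * (if l = i0 then \<eta> else 0)) \<le> (\<Sum>l\<in>S. a l q * (if l = i0 then \<eta> else 0))"
      using \<eta> q1 by (intro fnorm_le_sum[OF p S(1)]) auto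
    also have "\<dots> = a i0 q * \<eta>" using S by (simp add: if_distrib cong: if_cong)
    also have "\<dots> = \<epsilon> / 2" using ai0 by (simp add: \<eta>_def)
    finally show "fnorm p {1..card S} (\<lambda>j. norm (a (i j) q *\<^sub>R b j)) < 2 * \<epsilon>"
      using e unfolding den by linarith
  next
    fix n assume n: "n \<le> M" "C < nrm m (T n y)"
    \<comment> \<open>Restricting to nonzero coordinates of \<open>T n y\<close> guarantees
      \<open>y l \<noteq> 0\<close> after translation, hence membership in \<open>S\<close>.\<close>
    let ?G = "{l \<in> F n. T n y l \<noteq> 0}"
    have "C < fnorm p (F n) (wt m (T n y))" by (rule F(2)[OF n(2)])
    also have "\<dots> = fnorm p ?G (wt m (T n y))"
      using F(1) m by (intro fnorm_neutral[OF p]) auto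
    also have "\<dots> = fnorm p ?G (\<lambda>l. a (l + int n - int n) m * norm (y (l + int n) * weight_prod w (l + int n) n))"
      by (simp add: T_apply mult.commute)
    also have "\<dots> = fnorm p ((\<lambda>l. l + int n) ` ?G) (\<lambda>l. a (l - int n) m * norm (y l * weight_prod w l n))"
      by (rule fnorm_reindex[symmetric]) (simp add: inj_on_def)
    also have "\<dots> \<le> fnorm p S (\<lambda>l. a (l - int n) m * norm (\<beta> l * weight_prod w l n))"
    proof (rule fnorm_mono[OF p S(1)])
      show "(\<lambda>l. l + int n) ` ?G \<subseteq> S" using n(1) by (auto simp: S_def T_apply)
      fix l assume "l \<in> (\<lambda>l. l + int n) ` ?G"
      then have "y l \<noteq> 0" by (auto simp: T_apply)
      then show "a (l - int n) m * norm (y l * weight_prod w l n) \<le> a (l - int n) m * norm (\<beta> l * weight_prod w l n)"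
        by (simp add: \<beta>_def)
    qed (use m in auto)
    finally show "C < fnorm p {1..card S} (\<lambda>j. norm (a (i j - int n) m *\<^sub>R (b j * weight_prod w (i j) n)))"
      unfolding num .
  qed
qed

lemma necessity:
  assumes dc: "distributionally_chaotic X (koethe_dist p a) (backward_shift w)"
  obtains D I m N where "D \<subseteq> {1..}" "upper_density D = 1" "orbit_condition D I" "m \<ge> 1"
    "strict_mono_on {1..} N" "\<forall>k\<ge>1. N k > 0" "growth_condition I m N"
proof -
  obtain \<Gamma> \<epsilon> where \<Gamma>: "\<Gamma> \<subseteq> X" "uncountable \<Gamma>" "\<epsilon> > 0"
    and pairs: "\<forall>x\<in>\<Gamma>. \<forall>y\<in>\<Gamma>. x \<noteq> y \<longrightarrow>
      liminf (\<lambda>k. ereal (real (card {n \<in> {1..k}. koethe_dist p a (T n x) (T n y) < \<epsilon>}) / real k)) = 0 \<and>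
      (\<forall>\<tau>>0.
        limsup (\<lambda>k. ereal (real (card {n \<in> {1..k}. koethe_dist p a (T n x) (T n y) < \<tau>}) / real k)) = 1)"
    using dc unfolding distributionally_chaotic_def by (elim exE conjE)
  have "\<exists>x\<in>\<Gamma>. \<exists>y\<in>\<Gamma>. x \<noteq> y"
  proof (rule ccontr)
    assume "\<not> ?thesis"
    then have "\<Gamma> = {} \<or> (\<exists>x. \<Gamma> = {x})" by blast
    then show False using \<Gamma>(2) by auto
  qed
  then obtain x y where xy: "x \<in> \<Gamma>" "y \<in> \<Gamma>" "x \<noteq> y" by blast
  define u where "u = (\<lambda>j. x j - y j)"
  have xX: "x \<in> X" and yX: "y \<in> X" using xy \<Gamma>(1) by auto
  have u: "u \<in> X" unfolding u_def by (rule space_diff[OF xX yX])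
  define d where "d = (\<lambda>n. gauge (T n u))"
  have d_eq: "koethe_dist p a (T n x) (T n y) = d n" for n
    unfolding d_def u_def by (rule dist_T[OF xX yX])
  have set_eq: "{n \<in> {1..k}. P n} = {1..k} \<inter> {n. P n}" for k :: nat and P by auto
  have full_large: "full (- {n. d n < \<epsilon>})"
    using conjunct1[OF pairs[rule_format, OF xy]] unfolding d_eq set_eq liminf_frequency_eq_0_iff .
  have full_small: "full {n. d n < \<tau>}" if "\<tau> > 0" for \<tau>
    using conjunct2[OF pairs[rule_format, OF xy], rule_format, OF that] unfolding d_eq set_eq limsup_frequency_eq_1_iff .
  have d_nonneg: "0 \<le> d n" for n unfolding d_def by (rule gauge_nonneg[OF T_in_space[OF u]])
  obtain D where D: "D \<subseteq> {1..}" "full D" "(d \<longlongrightarrow> 0) (inf sequentially (principal D))"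
    using full_pseudo_intersection[OF d_nonneg full_small] by blast
  have nrm_d: "eventually (\<lambda>n. nrm q (T n u) < \<delta>) (inf sequentially (principal D))"
    if q: "q \<ge> 1" and \<delta>: "\<delta> > 0" for q \<delta>
  proof -
    have "eventually (\<lambda>n. d n < (1 / 2) ^ q * min 1 \<delta>) (inf sequentially (principal D))"
      using \<delta> by (intro order_tendstoD(2)[OF D(3)]) auto
    then show ?thesis
    proof (rule eventually_mono)
      fix n assume "d n < (1 / 2) ^ q * min 1 \<delta>"
      then have "(1 / 2) ^ q * min 1 (nrm q (T n u)) < (1 / 2) ^ q * min 1 \<delta>"
        using gauge_ge[OF T_in_space[OF u] q, of n] unfolding d_def by linarith
      then have "min 1 (nrm q (T n u)) < min 1 \<delta>" by (rule mult_left_less_imp_less) simp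
      then show "nrm q (T n u) < \<delta>" by linarith
    qed
  qed
  define I where "I = {i. \<exists>s. T s u i \<noteq> 0}"
  have orb: "orbit_condition D I"
    unfolding orbit_condition_def
  proof (intro allI impI ballI)
    fix k :: nat and i assume k: "k \<ge> 1" and "i \<in> I"
    then obtain s where s: "T s u i \<noteq> 0" unfolding I_def by blast
    show "((\<lambda>n. a (i - int n) k *\<^sub>R weight_prod w i n) \<longlongrightarrow> 0) (inf sequentially (principal D))"
      unfolding tendsto_iff
    proof (intro allI impI)
      fix \<tau> :: real assume \<tau>: "\<tau> > 0"
      \<comment> \<open>Continuity of \<open>T s\<close> is used with this tolerance; dividing the
        coordinate estimate by the fixed number \<open>norm (T s u i)\<close> then leaves
        \<open>\<tau>\<close>.\<close>
      have "\<tau> * norm (T s u i) > 0" using \<tau> s by simp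
      then obtain q \<delta> where q: "q \<ge> 1" "\<delta> > 0"
        "\<And>x. x \<in> X \<Longrightarrow> nrm q x < \<delta> \<Longrightarrow> nrm k (T s x) < \<tau> * norm (T s u i)"
        using T_bounded[OF k] by blast
      show "eventually (\<lambda>n. dist (a (i - int n) k *\<^sub>R weight_prod w i n) 0 < \<tau>) (inf sequentially (principal D))"
        using nrm_d[OF q(1,2)]
      proof (rule eventually_mono)
        fix n assume "nrm q (T n u) < \<delta>"
        then have less: "nrm k (T s (T n u)) < \<tau> * norm (T s u i)" by (intro q(3) T_in_space u)
        have "T s (T n u) = T n (T s u)" by (metis T_add add.commute)
        then have "a (i - int n) k * norm (weight_prod w i n) * norm (T s u i) = wt k (T s (T n u)) (i - int n)"
          by (simp add: T_apply[of n "T s u"] norm_mult)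
        also have "\<dots> \<le> nrm k (T s (T n u))" by (intro wt_le_nrm T_in_space u k)
        also note less
        finally have "a (i - int n) k * norm (weight_prod w i n) < \<tau>"
          using s by (simp add: mult_less_cancel_right)
        then show "dist (a (i - int n) k *\<^sub>R weight_prod w i n) 0 < \<tau>" using k by simp
      qed
    qed
  qed
  \<comment> \<open>With \<open>(1 / 2) ^ m \<le> \<delta>\<close>, a gauge of at least
    \<open>\<epsilon>\<close> leaves at least \<open>\<delta>\<close> for seminorm \<open>m\<close>
    by \<open>gauge_le\<close>.\<close>
  define \<delta> where "\<delta> = \<epsilon> / 2"
  have \<delta>: "\<delta> > 0" using \<Gamma>(3) by (simp add: \<delta>_def)
  obtain m :: nat where m: "m \<ge> 1" "(1 / 2) ^ m \<le> \<delta>" using half_power_le[OF \<delta>] by blast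
  define E where "E = {n. \<delta> \<le> nrm m (T n u)}"
  have E: "full E"
  proof (rule full_mono[OF full_large])
    fix n assume "n \<in> - {n. d n < \<epsilon>}"
    then show "n \<in> E"
      using gauge_le[OF T_in_space[OF u] m(1), of n] m(2) by (simp add: E_def d_def \<delta>_def)
  qed
  obtain n0 where "n0 \<in> E" using full_infinite[OF E] by blast
  then have "0 < nrm m (T n0 u)" using \<delta> by (simp add: E_def)
  then obtain i0 where i0: "a i0 m > 0" "T n0 u i0 \<noteq> 0" using nrm_posE[OF T_in_space[OF u] m(1)] by blast
  \<comment> \<open>Truncation at most doubles this bound, so denominators stay below
    \<open>\<delta> / (2 * k)\<close>; numerators above \<open>\<delta> / 2\<close> then give
    quotients above \<open>k\<close>.\<close>
  have "\<exists>s. nrm (index_fun m k) (T s u) < \<delta> / (4 * real k)" if "k \<ge> 1" for k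
  proof -
    have "eventually (\<lambda>n. n \<in> D \<longrightarrow> nrm (index_fun m k) (T n u) < \<delta> / (4 * real k)) sequentially"
      using nrm_d[OF index_fun_ge(2)[OF m(1)], of "\<delta> / (4 * real k)" k] \<delta> that
      by (simp add: eventually_inf_principal)
    then obtain L where "\<And>n. n \<ge> L \<Longrightarrow> n \<in> D \<Longrightarrow> nrm (index_fun m k) (T n u) < \<delta> / (4 * real k)"
      by (auto simp: eventually_sequentially)
    then show ?thesis using full_infinite[OF D(2), of L] by blast
  qed
  then obtain s where s: "\<And>k. k \<ge> 1 \<Longrightarrow> nrm (index_fun m k) (T (s k) u) < \<delta> / (4 * real k)" by metis
  \<comment> \<open>The orbit of \<open>T (s k) u\<close> at time \<open>n\<close> is that of
    \<open>u\<close> at time \<open>n + s k\<close>, hence the shifted set. The term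
    \<open>max 1 k\<close> keeps the requirement satisfiable at \<open>k = 0\<close>, where
    \<open>1 / k\<close> would be 0.\<close>
  have "\<exists>N. \<forall>k. (real (card ({1..N k} - {n. n + s k \<in> E})) < 1 / real (max 1 k) * real (N k)) \<and> N k < N (Suc k)"
  proof (rule dependent_nat_choice)
    show "\<exists>N. real (card ({1..N} - {n. n + s 0 \<in> E})) < 1 / real (max 1 0) * real N"
      using fullD[OF full_shift[OF E, of "s 0"], of 1] by auto
    show "\<exists>N'. real (card ({1..N'} - {n. n + s (Suc k) \<in> E})) < 1 / real (max 1 (Suc k)) * real N' \<and> N < N'" for N k
    proof -
      obtain N' where "N' \<ge> Suc N" "real (card ({1..N'} - {n. n + s (Suc k) \<in> E})) < 1 / real (max 1 (Suc k)) * real N'"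
        using fullD[OF full_shift[OF E, of "s (Suc k)"], of "1 / real (max 1 (Suc k))" "Suc N"] by auto
      then show ?thesis by (intro exI[of _ N']) auto
    qed
  qed
  then obtain N where N: "\<And>k. real (card ({1..N k} - {n. n + s k \<in> E})) < 1 / real (max 1 k) * real (N k)"
    "\<And>k. N k < N (Suc k)" by blast
  have growth: "growth_condition I m N"
    unfolding growth_condition_def
  proof (intro allI impI)
    fix k :: nat assume k: "k \<ge> 1"
    let ?q = "index_fun m k" and ?y = "T (s k) u"
    have e: "\<delta> / (4 * real k) > 0" using \<delta> k by simp
    obtain r and i :: "nat \<Rightarrow> int" and b :: "nat \<Rightarrow> 'a" where r: "r \<ge> 1"
      "\<And>j. j \<in> {1..r} \<Longrightarrow> i j = i0 \<or> ?y (i j) \<noteq> 0" "\<And>j. j \<in> {1..r} \<Longrightarrow> b j \<noteq> 0"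
      "0 < fnorm p {1..r} (\<lambda>j. norm (a (i j) ?q *\<^sub>R b j))"
      "fnorm p {1..r} (\<lambda>j. norm (a (i j) ?q *\<^sub>R b j)) < 2 * (\<delta> / (4 * real k))"
      "\<And>n. n \<le> N k \<Longrightarrow> \<delta> / 2 < nrm m (T n ?y) \<Longrightarrow>
        \<delta> / 2 < fnorm p {1..r} (\<lambda>j. norm (a (i j - int n) m *\<^sub>R (b j * weight_prod w (i j) n)))"
      using truncated_orbit_growth[OF T_in_space[OF u] m(1) index_fun_ge(1)[OF m(1)] e s[OF k] i0(1)] by blast
    let ?den = "fnorm p {1..r} (\<lambda>j. norm (a (i j) ?q *\<^sub>R b j))"
    let ?num = "\<lambda>n. fnorm p {1..r} (\<lambda>j. norm (a (i j - int n) m *\<^sub>R (b j * weight_prod w (i j) n)))"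
    have I: "i j \<in> I" if "j \<in> {1..r}" for j
      using r(2)[OF that] i0(2) unfolding I_def by blast
    have "real k * ?den \<le> real k * (2 * (\<delta> / (4 * real k)))"
      using r(5) by (intro mult_left_mono) auto
    also have "\<dots> = \<delta> / 2" using k by simp
    finally have den: "real k * ?den \<le> \<delta> / 2" .
    have "real k < ?num n / ?den" if "n \<le> N k" "n + s k \<in> E" for n
    proof -
      have "\<delta> \<le> nrm m (T n ?y)" using that(2) unfolding E_def T_add[symmetric] by simp
      \<comment> \<open>Truncation preserves strict lower bounds, whereas \<open>E\<close> gives
        only \<open>\<ge> \<delta>\<close>; passing to \<open>\<delta> / 2\<close> restores
        strictness.\<close>
      then have "\<delta> / 2 < ?num n" using \<delta> by (intro r(6)[OF that(1)]) linarith
      then have "real k * ?den < ?num n" using den by linarith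
      then show ?thesis by (simp only: pos_less_divide_eq[OF r(4)])
    qed
    then have "card ({1..N k} - {n. real k < ?num n / ?den}) \<le> card ({1..N k} - {n. n + s k \<in> E})"
      by (intro card_mono) auto
    then have "real (card ({1..N k} - {n. real k < ?num n / ?den})) < 1 / real k * real (N k)"
      using N(1)[of k] k by (simp add: max_def)
    then have "real (card {n \<in> {1..N k}. n \<in> {n. real k < ?num n / ?den}}) > (1 - 1 / real k) * real (N k)"
      unfolding card_frequency_iff .
    then show "\<exists>r\<ge>1. \<exists>(i :: nat \<Rightarrow> int) (b :: nat \<Rightarrow> 'a).
        (\<forall>j\<in>{1..r}. i j \<in> I \<and> b j \<noteq> 0) \<and>
        fnorm p {1..r} (\<lambda>j. norm (a (i j) ?q *\<^sub>R b j)) > 0 \<and>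
        real (card {n \<in> {1..N k}.
          fnorm p {1..r} (\<lambda>j. norm (a (i j - int n) m *\<^sub>R (b j * weight_prod w (i j) n))) /
          fnorm p {1..r} (\<lambda>j. norm (a (i j) ?q *\<^sub>R b j)) > real k})
        > (1 - 1 / real k) * real (N k)"
      using r(1,3,4) I by (intro exI[of _ r] exI[of _ i] exI[of _ b] conjI) auto
  qed
  have "strict_mono N" using N(2) by (simp add: strict_mono_Suc_iff)
  then have "strict_mono_on {1..} N" by (simp add: strict_mono_on_def strict_mono_less)
  moreover have "\<forall>k\<ge>1. N k > 0"
  proof (intro allI impI)
    fix k :: nat assume "k \<ge> 1"
    then show "N k > 0" using N(2)[of "k - 1"] by simp
  qed
  ultimately show ?thesis
    using that[OF D(1) _ orb m(1) _ _ growth] D(2) by (simp add: upper_density_eq_1_iff)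
qed

theorem distributionally_chaotic_iff:
  "distributionally_chaotic X (koethe_dist p a) (backward_shift w) \<longleftrightarrow>
    (\<exists>D I. D \<subseteq> {1..} \<and> upper_density D = 1 \<and> orbit_condition D I \<and>
      (\<exists>m\<ge>1. \<exists>N. strict_mono_on {1..} N \<and> (\<forall>k\<ge>1. N k > 0) \<and> growth_condition I m N))"
proof
  assume "distributionally_chaotic X (koethe_dist p a) (backward_shift w)"
  then show "\<exists>D I. D \<subseteq> {1..} \<and> upper_density D = 1 \<and> orbit_condition D I \<and>
      (\<exists>m\<ge>1. \<exists>N. strict_mono_on {1..} N \<and> (\<forall>k\<ge>1. N k > 0) \<and> growth_condition I m N)"
    by (rule necessity) blast
qed (use sufficiency in blast)

end

section \<open>Return to maxima and sums of powers\<close>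

lemma fnorm_0_eq_Max:
  assumes "finite F" "F \<noteq> {}" "\<And>j. j \<in> F \<Longrightarrow> 0 \<le> v j"
  shows "fnorm 0 F v = Max (v ` F)"
proof -
  have "0 \<le> Max (v ` F)" using assms by (meson Max_ge all_not_in_conv finite_imageI image_eqI order_trans)
  then show ?thesis using assms by (simp add: fnorm_def max_def)
qed

theorem corollary16:
  fixes a :: "int \<Rightarrow> nat \<Rightarrow> real"
    and p :: real
    and w :: "int \<Rightarrow> 'a::{real_normed_field,banach}"
  assumes "koethe_matrix a"
    and "p = 0 \<or> p \<ge> 1"
    and "\<forall>n. w n \<noteq> 0"
    and "backward_shift w ` koethe_space p a \<subseteq> koethe_space p a"
    and "continuous_map (koethe_topology p a) (koethe_topology p a) (backward_shift w)"
  shows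
   "(p = 0 \<longrightarrow>
      (distributionally_chaotic (koethe_space p a) (koethe_dist p a) (backward_shift w) \<longleftrightarrow>
       (\<exists>D I. D \<subseteq> {1..} \<and> upper_density D = 1 \<and>
          (\<forall>k\<ge>1. \<forall>i\<in>I.
             ((\<lambda>n. a (i - int n) k *\<^sub>R weight_prod w i n) \<longlongrightarrow> 0) (inf sequentially (principal D))) \<and>
          (\<exists>m\<ge>1. \<exists>N. strict_mono_on {1..} N \<and> (\<forall>k\<ge>1. N k > 0) \<and>
             (\<forall>k\<ge>1. \<exists>r\<ge>1. \<exists>(i :: nat \<Rightarrow> int) (b :: nat \<Rightarrow> 'a).
                (\<forall>j\<in>{1..r}. i j \<in> I \<and> b j \<noteq> 0) \<and>
                (MAX j\<in>{1..r}. norm (a (i j) (index_fun m k) *\<^sub>R b j)) > 0 \<and>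
                real (card {n \<in> {1..N k}.
                   (MAX j\<in>{1..r}. norm (a (i j - int n) m *\<^sub>R (b j * weight_prod w (i j) n))) /
                   (MAX j\<in>{1..r}. norm (a (i j) (index_fun m k) *\<^sub>R b j)) > real k})
                > (1 - 1 / real k) * real (N k))))))
    \<and>
    (p \<ge> 1 \<longrightarrow>
      (distributionally_chaotic (koethe_space p a) (koethe_dist p a) (backward_shift w) \<longleftrightarrow>
       (\<exists>D I. D \<subseteq> {1..} \<and> upper_density D = 1 \<and>
          (\<forall>k\<ge>1. \<forall>i\<in>I.
             ((\<lambda>n. a (i - int n) k *\<^sub>R weight_prod w i n) \<longlongrightarrow> 0) (inf sequentially (principal D))) \<and>
          (\<exists>m\<ge>1. \<exists>N. strict_mono_on {1..} N \<and> (\<forall>k\<ge>1. N k > 0) \<and>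
             (\<forall>k\<ge>1. \<exists>r\<ge>1. \<exists>(i :: nat \<Rightarrow> int) (b :: nat \<Rightarrow> 'a).
                (\<forall>j\<in>{1..r}. i j \<in> I \<and> b j \<noteq> 0) \<and>
                (\<Sum>j = 1..r. norm (a (i j) (index_fun m k) *\<^sub>R b j) powr p) > 0 \<and>
                real (card {n \<in> {1..N k}.
                   (\<Sum>j = 1..r. norm (a (i j - int n) m *\<^sub>R (b j * weight_prod w (i j) n)) powr p) /
                   (\<Sum>j = 1..r. norm (a (i j) (index_fun m k) *\<^sub>R b j) powr p) > real k powr p})
                > (1 - 1 / real k) * real (N k))))))"
proof -
  interpret koethe_shift p a w
    using assms by unfold_locales auto
  show ?thesis
  proof (intro conjI impI)
    assume p0: "p = 0"
    have Max_eq: "(MAX j\<in>{1..r}. norm (v j :: 'a)) = fnorm p {1..r} (\<lambda>j. norm (v j))" if "r \<ge> 1" for r :: nat and v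
      unfolding p0 using that by (intro fnorm_0_eq_Max[symmetric]) auto
    show "distributionally_chaotic (koethe_space p a) (koethe_dist p a) (backward_shift w) \<longleftrightarrow>
       (\<exists>D I. D \<subseteq> {1..} \<and> upper_density D = 1 \<and>
          (\<forall>k\<ge>1. \<forall>i\<in>I.
             ((\<lambda>n. a (i - int n) k *\<^sub>R weight_prod w i n) \<longlongrightarrow> 0) (inf sequentially (principal D))) \<and>
          (\<exists>m\<ge>1. \<exists>N. strict_mono_on {1..} N \<and> (\<forall>k\<ge>1. N k > 0) \<and>
             (\<forall>k\<ge>1. \<exists>r\<ge>1. \<exists>(i :: nat \<Rightarrow> int) (b :: nat \<Rightarrow> 'a).
                (\<forall>j\<in>{1..r}. i j \<in> I \<and> b j \<noteq> 0) \<and>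
                (MAX j\<in>{1..r}. norm (a (i j) (index_fun m k) *\<^sub>R b j)) > 0 \<and>
                real (card {n \<in> {1..N k}.
                   (MAX j\<in>{1..r}. norm (a (i j - int n) m *\<^sub>R (b j * weight_prod w (i j) n))) /
                   (MAX j\<in>{1..r}. norm (a (i j) (index_fun m k) *\<^sub>R b j)) > real k})
                > (1 - 1 / real k) * real (N k))))"
      \<comment> \<open>Here \<open>conj_cong\<close> supplies \<open>r \<ge> 1\<close>, without
        which \<open>MAX\<close> would range over an empty set.\<close>
      unfolding distributionally_chaotic_iff orbit_condition_def growth_condition_def
      by (simp only: Max_eq cong: conj_cong)
  next
    assume p1: "p \<ge> 1"
    have pos: "(\<Sum>j = 1..r. norm (v j :: 'a) powr p) > 0 \<longleftrightarrow> fnorm p {1..r} (\<lambda>j. norm (v j)) > 0" for r :: nat and v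
      unfolding fnorm_powr[OF p1, symmetric] using fnorm_nonneg[of "{1..r}" p "\<lambda>j. norm (v j)"]
      by (simp add: order.strict_iff_order)
    \<comment> \<open>Both sides differ by the power \<open>p\<close>, which is strictly increasing
      on nonnegative numbers.\<close>
    have quot: "(\<Sum>j = 1..r. norm (v j :: 'a) powr p) / (\<Sum>j = 1..r. norm (v' j :: 'a) powr p) > real k powr p \<longleftrightarrow>
        fnorm p {1..r} (\<lambda>j. norm (v j)) / fnorm p {1..r} (\<lambda>j. norm (v' j)) > real k" for r k :: nat and v v'
    proof -
      define c where "c = fnorm p {1..r} (\<lambda>j. norm (v j)) / fnorm p {1..r} (\<lambda>j. norm (v' j))"
      have "(\<Sum>j = 1..r. norm (v j) powr p) / (\<Sum>j = 1..r. norm (v' j) powr p) = c powr p"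
        unfolding c_def fnorm_powr[OF p1, symmetric] by (intro powr_divide[symmetric] fnorm_nonneg)
      moreover have "0 \<le> c"
        unfolding c_def by (intro divide_nonneg_nonneg fnorm_nonneg) auto
      then have "real k powr p < c powr p \<longleftrightarrow> real k < c"
        using p1 powr_less_mono2[of p "real k" c] powr_mono2[of p c "real k"] by fastforce
      ultimately show ?thesis unfolding c_def by simp
    qed
    show "distributionally_chaotic (koethe_space p a) (koethe_dist p a) (backward_shift w) \<longleftrightarrow>
       (\<exists>D I. D \<subseteq> {1..} \<and> upper_density D = 1 \<and>
          (\<forall>k\<ge>1. \<forall>i\<in>I.
             ((\<lambda>n. a (i - int n) k *\<^sub>R weight_prod w i n) \<longlongrightarrow> 0) (inf sequentially (principal D))) \<and>
          (\<exists>m\<ge>1. \<exists>N. strict_mono_on {1..} N \<and> (\<forall>k\<ge>1. N k > 0) \<and>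
             (\<forall>k\<ge>1. \<exists>r\<ge>1. \<exists>(i :: nat \<Rightarrow> int) (b :: nat \<Rightarrow> 'a).
                (\<forall>j\<in>{1..r}. i j \<in> I \<and> b j \<noteq> 0) \<and>
                (\<Sum>j = 1..r. norm (a (i j) (index_fun m k) *\<^sub>R b j) powr p) > 0 \<and>
                real (card {n \<in> {1..N k}.
                   (\<Sum>j = 1..r. norm (a (i j - int n) m *\<^sub>R (b j * weight_prod w (i j) n)) powr p) /
                   (\<Sum>j = 1..r. norm (a (i j) (index_fun m k) *\<^sub>R b j) powr p) > real k powr p})
                > (1 - 1 / real k) * real (N k))))"
      unfolding distributionally_chaotic_iff orbit_condition_def growth_condition_def pos quot ..
  qed
qed

end
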